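(* Let $G=(\mathcal V,\mathcal E)$ be a finite undirected graph with finite label sets and potentials $\theta$. Run Algorithm 1 with the reparametrized potentials $\theta^\psi$ (as described in the context): $\mu^0\in\operatorname{arg\,min}_{\mu\in\Lambda_{\mathcal V}}E_{\mathcal V}(\mu)$ is chosen, it yields $A^0$ and the proposal labeling $x^0$ on $A^0$, arbitrarily extended to $y\in X_{\mathcal V}$, and $\psi_{v,u}(x_v)=-\theta_{uv}(y_u,x_v)$ for all $uv\in\mathcal E$ (both orientations). Suppose that for every $t=0,1,\dots$ occurring in the iterations the problem $\min_{\mu\in\Lambda_{A^t}}\hat E^\psi_{A^t,x^t}(\mu)$ has a unique solution. Then the algorithm finds the maximal strictly $\Lambda_{\mathcal V}$-improving all-to-one mapping for the given proposal labeling; that is, its output set $A^\ast$ is the largest set $A\subset\mathcal V$ for which the mapping $p$ given by $$p_v(i)=\begin{cases}y_v,&v\in A,\\ i,&v\notin A,\end{cases}$$ is strictly $\Lambda_{\mathcal V}$-improving for $\theta$.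
   Context: For $A\subset\mathcal V$, $X_A=\prod_{v\in A}X_v$, with label sets finite and nonempty, and $\theta_{uv}(x_u,x_v)=\theta_{vu}(x_v,x_u)$. $E_A(x)=\sum_{u\in A}\theta_u(x_u)+\sum_{uv\in\mathcal E:\,u,v\in A}\theta_{uv}(x_u,x_v)$. Boundary nodes: $\partial\mathcal V_A=\{u\in A:\exists v\in\mathcal V\setminus A,\ uv\in\mathcal E\}$; boundary edges: $\partial\mathcal E_A=\{uv\in\mathcal E:u\in A,\ v\in\mathcal V\setminus A\}$. For $uv\in\partial\mathcal E_A$ with $u\in A$ and a test label $y_u$: $\hat\theta_{uv,y_u}(x_u)=\max_{x_v\in X_v}\theta_{uv}(x_u,x_v)$ if $x_u=y_u$, and $\hat\theta_{uv,y_u}(x_u)=\min_{x_v\in X_v}\theta_{uv}(x_u,x_v)$ if $x_u\neq y_u$. $\hat E_{A,y}(x)=E_A(x)+\sum_{uv\in\partial\mathcal E_A:\,u\in\partial\mathcal V_A}\hat\theta_{uv,y_u}(x_u)$ (only the restriction of $y$ to $\partial\mathcal V_A$ matters). The local polytope $\Lambda_A$ is the set of nonnegative vectors $\mu$ with components $\mu_v(x_v)$ ($v\in A$, $x_v\in X_v$) and $\mu_{uv}(x_u,x_v)$ ($uv\in\mathcal E$, $u,v\in A$) such that $\sum_{x_v\in X_v}\mu_v(x_v)=1$, $\sum_{x_v\in X_v}\mu_{uv}(x_u,x_v)=\mu_u(x_u)$ and $\sum_{x_u\in X_u}\mu_{uv}(x_u,x_v)=\mu_v(x_v)$. For $x\in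 X_A$, $\delta(x)\in\Lambda_A$ is its indicator vector. Energies that are sums of unary and pairwise terms are extended linearly to $\Lambda_A$ (each $f_v$ becomes $\sum_{x_v}f_v(x_v)\mu_v(x_v)$, each $f_{uv}$ becomes $\sum_{x_u,x_v}f_{uv}(x_u,x_v)\mu_{uv}(x_u,x_v)$); write $E_{\mathcal V}(\mu)=\langle\theta,\mu\rangle$ with $\theta,\mu\in\mathbb R^{\mathcal I}$, $|\mathcal I|=\sum_{v}|X_v|+\sum_{uv}|X_u||X_v|$. A reparametrization is a vector $\varphi$ of reals $\varphi_{v,u}(x_v)$; $\theta^\varphi_v(x_v)=\theta_v(x_v)-\sum_{u:\,uv\in\mathcal E}\varphi_{v,u}(x_v)$, $\theta^\varphi_{uv}(x_u,x_v)=\theta_{uv}(x_u,x_v)+\varphi_{v,u}(x_v)+\varphi_{u,v}(x_u)$. $\hat E^\varphi_{A,y}$ denotes $\hat E_{A,y}$ constructed from $\theta^\varphi$. Algorithm 1 with $\theta^\psi$. Initialize: choose $\mu^0\in\operatorname{arg\,min}_{\mu\in\Lambda_{\mathcal V}}E_{\mathcal V}(\mu)$ (this objective on $\Lambda_{\mathcal V}$ is unchanged by reparametrization), set $A^0=\{u\in\mathcal V:\mu^0_u\in\{0,1\}^{|X_u|}\}$, $t=0$. Repeat: (1) let $x^t\in X_{A^t}$ be given by $\mu^t_u(x^t_u)=1$, $u\in A^t$ (for $t=0$ this is the proposal labeling, which also determines $y$ and $\psi$, kept fixed in all iterations); (2) choose $\mu^{t+1}\in\operatorname{arg\,min}_{\mu\in\Lambda_{A^t}}\hat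 E^\psi_{A^t,x^t}(\mu)$; (3) $t:=t+1$; (4) $W^t=\{u\in\partial\mathcal V_{A^{t-1}}:\mu^t_u(x^{t-1}_u)\neq1\}$; (5) $A^t=\{u\in A^{t-1}:\mu^t_u\in\{0,1\}^{|X_u|}\}\setminus W^t$; until $A^t=A^{t-1}$. Output $A^\ast=A^t$ and $x^\ast$ with $\mu^t_u(x^\ast_u)=1$, $u\in A^\ast$. For a node-wise mapping $p:X_{\mathcal V}\to X_{\mathcal V}$, $p(x)_v=p_v(x_v)$ with each $p_v:X_v\to X_v$ idempotent, let $P_v\in\mathbb R^{X_v\times X_v}$ have entries $P_{v,ii'}=1$ if $p_v(i')=i$ and $0$ otherwise. The linear extension $[p]:\mathbb R^{\mathcal I}\to\mathbb R^{\mathcal I}$ is $([p]\mu)_v=P_v\mu_v$, $([p]\mu)_{uv}=P_u\mu_{uv}P_v^\top$. $p$ is $\Lambda_{\mathcal V}$-improving for $\theta$ if $\min_{\mu\in\Lambda_{\mathcal V}}\langle(I-[p])^\top\theta,\mu\rangle=0$, and strictly $\Lambda_{\mathcal V}$-improving if additionally $[p]\mu=\mu$ for all minimizers $\mu$. *)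

theory Defs
  imports Complex_Main "HOL-Library.FuncSet"
begin

text \<open>
  A model has a node set \<open>V\<close>, a set \<open>E\<close> of two-element edges \<open>{u, v}\<close> and label sets \<open>X v\<close>.
  Vectors indexed by node labels and edge label pairs are functions on the type below.  A pairwise
  component can be read in both orientations; both entries denote the same coordinate, which is
  enforced by the symmetry condition in \<open>ivec_space\<close>.
\<close>

datatype ('v, 'l) idx = NodeIx 'v 'l | EdgeIx 'v 'v 'l 'l

type_synonym ('v, 'l) ivec = "('v, 'l) idx \<Rightarrow> real"

definition simple_graph :: "'v set \<Rightarrow> 'v set set \<Rightarrow> bool" where
  "simple_graph V E \<longleftrightarrow> finite V \<and> (\<forall>e\<in>E. e \<subseteq> V \<and> card e = 2)"

definition index_set :: "'v set set \<Rightarrow> ('v \<Rightarrow> 'l set) \<Rightarrow> 'v set \<Rightarrow> ('v, 'l) idx set" where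
  "index_set E X A =
     {NodeIx v i | v i. v \<in> A \<and> i \<in> X v} \<union>
     {EdgeIx u v i j | u v i j. u \<in> A \<and> v \<in> A \<and> {u, v} \<in> E \<and> i \<in> X u \<and> j \<in> X v}"

text \<open>
  The real vectors indexed by \<open>index_set E X A\<close>.  Entries off the index set are zero, so
  that equality of functions is equality of vectors.
\<close>

definition ivec_space :: "'v set set \<Rightarrow> ('v \<Rightarrow> 'l set) \<Rightarrow> 'v set \<Rightarrow> ('v, 'l) ivec set" where
  "ivec_space E X A =
     {\<mu>. (\<forall>k. k \<notin> index_set E X A \<longrightarrow> \<mu> k = 0) \<and>
         (\<forall>u v i j. \<mu> (EdgeIx u v i j) = \<mu> (EdgeIx v u j i))}"

text \<open>
  The linear extension of the energy on \<open>A\<close>; for \<open>A = V\<close> it is the inner product of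
  \<open>\<theta>\<close> and \<open>\<mu>\<close>.  The factor one half makes every undirected edge count once.
\<close>

definition energy ::
  "'v set set \<Rightarrow> ('v \<Rightarrow> 'l set) \<Rightarrow> 'v set \<Rightarrow> ('v, 'l) ivec \<Rightarrow> ('v, 'l) ivec \<Rightarrow> real" where
  "energy E X A \<theta> \<mu> =
     (\<Sum>v\<in>A. \<Sum>i\<in>X v. \<theta> (NodeIx v i) * \<mu> (NodeIx v i)) +
     (\<Sum>(u, v) \<in> {(u, v). u \<in> A \<and> v \<in> A \<and> {u, v} \<in> E}.
        \<Sum>i\<in>X u. \<Sum>j\<in>X v. \<theta> (EdgeIx u v i j) * \<mu> (EdgeIx u v i j)) / 2"

definition local_polytope ::
  "'v set set \<Rightarrow> ('v \<Rightarrow> 'l set) \<Rightarrow> 'v set \<Rightarrow> ('v, 'l) ivec set" where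
  "local_polytope E X A =
     {\<mu> \<in> ivec_space E X A.
        (\<forall>k. 0 \<le> \<mu> k) \<and>
        (\<forall>v\<in>A. (\<Sum>i\<in>X v. \<mu> (NodeIx v i)) = 1) \<and>
        (\<forall>u\<in>A. \<forall>v\<in>A. {u, v} \<in> E \<longrightarrow>
           (\<forall>i\<in>X u. (\<Sum>j\<in>X v. \<mu> (EdgeIx u v i j)) = \<mu> (NodeIx u i)) \<and>
           (\<forall>j\<in>X v. (\<Sum>i\<in>X u. \<mu> (EdgeIx u v i j)) = \<mu> (NodeIx v j)))}"

definition boundary_nodes :: "'v set \<Rightarrow> 'v set set \<Rightarrow> 'v set \<Rightarrow> 'v set" where
  "boundary_nodes V E A = {u \<in> A. \<exists>v \<in> V - A. {u, v} \<in> E}"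

text \<open>Boundary edges are listed with their inner end first.\<close>

definition boundary_edges :: "'v set \<Rightarrow> 'v set set \<Rightarrow> 'v set \<Rightarrow> ('v \<times> 'v) set" where
  "boundary_edges V E A = {(u, v). u \<in> A \<and> v \<in> V - A \<and> {u, v} \<in> E}"

definition hat_pot ::
  "('v \<Rightarrow> 'l set) \<Rightarrow> ('v, 'l) ivec \<Rightarrow> 'v \<Rightarrow> 'v \<Rightarrow> 'l \<Rightarrow> 'l \<Rightarrow> real" where
  "hat_pot X \<theta> u v a i =
     (if i = a then Max ((\<lambda>j. \<theta> (EdgeIx u v i j)) ` X v)
      else Min ((\<lambda>j. \<theta> (EdgeIx u v i j)) ` X v))"

definition hat_energy ::
  "'v set \<Rightarrow> 'v set set \<Rightarrow> ('v \<Rightarrow> 'l set) \<Rightarrow> 'v set \<Rightarrow> ('v \<Rightarrow> 'l) \<Rightarrow>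
   ('v, 'l) ivec \<Rightarrow> ('v, 'l) ivec \<Rightarrow> real" where
  "hat_energy V E X A y \<theta> \<mu> =
     energy E X A \<theta> \<mu> +
     (\<Sum>(u, v) \<in> boundary_edges V E A. \<Sum>i\<in>X u. hat_pot X \<theta> u v (y u) i * \<mu> (NodeIx u i))"

text \<open>\<open>\<phi> v u i\<close> is the message at label \<open>i\<close> of \<open>v\<close> for the edge between \<open>u\<close> and \<open>v\<close>.\<close>

fun reparam ::
  "'v set set \<Rightarrow> ('v \<Rightarrow> 'v \<Rightarrow> 'l \<Rightarrow> real) \<Rightarrow> ('v, 'l) ivec \<Rightarrow> ('v, 'l) ivec" where
  "reparam E \<phi> \<theta> (NodeIx v i) = \<theta> (NodeIx v i) - (\<Sum>u \<in> {u. {u, v} \<in> E}. \<phi> v u i)"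
| "reparam E \<phi> \<theta> (EdgeIx u v i j) = \<theta> (EdgeIx u v i j) + \<phi> v u j + \<phi> u v i"

definition psi :: "('v, 'l) ivec \<Rightarrow> ('v \<Rightarrow> 'l) \<Rightarrow> 'v \<Rightarrow> 'v \<Rightarrow> 'l \<Rightarrow> real" where
  "psi \<theta> y v u j = - \<theta> (EdgeIx u v (y u) j)"

definition integral_nodes :: "('v \<Rightarrow> 'l set) \<Rightarrow> 'v set \<Rightarrow> ('v, 'l) ivec \<Rightarrow> 'v set" where
  "integral_nodes X A \<mu> = {u \<in> A. \<forall>i \<in> X u. \<mu> (NodeIx u i) \<in> {0, 1}}"

definition labeling_of ::
  "('v \<Rightarrow> 'l set) \<Rightarrow> 'v set \<Rightarrow> ('v, 'l) ivec \<Rightarrow> ('v \<Rightarrow> 'l) \<Rightarrow> bool" where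
  "labeling_of X A \<mu> x \<longleftrightarrow> x \<in> PiE A X \<and> (\<forall>u\<in>A. \<mu> (NodeIx u (x u)) = 1)"

definition subproblem_solution ::
  "'v set \<Rightarrow> 'v set set \<Rightarrow> ('v \<Rightarrow> 'l set) \<Rightarrow> ('v, 'l) ivec \<Rightarrow>
   'v set \<Rightarrow> ('v \<Rightarrow> 'l) \<Rightarrow> ('v, 'l) ivec \<Rightarrow> bool" where
  "subproblem_solution V E X \<theta> A x \<mu> \<longleftrightarrow>
     is_arg_min (hat_energy V E X A x \<theta>) (\<lambda>\<mu>. \<mu> \<in> local_polytope E X A) \<mu>"

text \<open>
  One pass through the loop, from a current set and labeling \<open>(A, x)\<close> to \<open>(A', x')\<close>.
  It is a relation because the minimizer is chosen.
\<close>

definition prune_step ::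
  "'v set \<Rightarrow> 'v set set \<Rightarrow> ('v \<Rightarrow> 'l set) \<Rightarrow> ('v, 'l) ivec \<Rightarrow>
   'v set \<Rightarrow> ('v \<Rightarrow> 'l) \<Rightarrow> 'v set \<Rightarrow> ('v \<Rightarrow> 'l) \<Rightarrow> bool" where
  "prune_step V E X \<theta> A x A' x' \<longleftrightarrow>
     (\<exists>\<mu> W. subproblem_solution V E X \<theta> A x \<mu> \<and>
            W = {u \<in> boundary_nodes V E A. \<mu> (NodeIx u (x u)) \<noteq> 1} \<and>
            A' = integral_nodes X A \<mu> - W \<and>
            labeling_of X A' \<mu> x')"

text \<open>
  \<open>prune_state V E X \<theta> A0 x0 t A x\<close>: an execution started at \<open>(A0, x0)\<close> enters the loop body
  for the iteration \<open>t\<close> with current set \<open>A\<close> and labeling \<open>x\<close>.  The body is not entered again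
  after a pass that left the set unchanged.
\<close>

inductive prune_state ::
  "'v set \<Rightarrow> 'v set set \<Rightarrow> ('v \<Rightarrow> 'l set) \<Rightarrow> ('v, 'l) ivec \<Rightarrow>
   'v set \<Rightarrow> ('v \<Rightarrow> 'l) \<Rightarrow> nat \<Rightarrow> 'v set \<Rightarrow> ('v \<Rightarrow> 'l) \<Rightarrow> bool"
  for V E X \<theta> A0 x0 where
  start: "prune_state V E X \<theta> A0 x0 0 A0 x0"
| repeat: "\<lbrakk>prune_state V E X \<theta> A0 x0 t A x; prune_step V E X \<theta> A x A' x'; A' \<noteq> A\<rbrakk>
    \<Longrightarrow> prune_state V E X \<theta> A0 x0 (Suc t) A' x'"

definition prune_output ::
  "'v set \<Rightarrow> 'v set set \<Rightarrow> ('v \<Rightarrow> 'l set) \<Rightarrow> ('v, 'l) ivec \<Rightarrow>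
   'v set \<Rightarrow> ('v \<Rightarrow> 'l) \<Rightarrow> 'v set \<Rightarrow> ('v \<Rightarrow> 'l) \<Rightarrow> bool" where
  "prune_output V E X \<theta> A0 x0 A' x' \<longleftrightarrow>
     (\<exists>t A x. prune_state V E X \<theta> A0 x0 t A x \<and> prune_step V E X \<theta> A x A' x' \<and> A' = A)"

definition idempotent_map :: "'v set \<Rightarrow> ('v \<Rightarrow> 'l set) \<Rightarrow> ('v \<Rightarrow> 'l \<Rightarrow> 'l) \<Rightarrow> bool" where
  "idempotent_map V X p \<longleftrightarrow> (\<forall>v\<in>V. p v ` X v \<subseteq> X v \<and> (\<forall>i\<in>X v. p v (p v i) = p v i))"

definition map_matrix :: "('v \<Rightarrow> 'l \<Rightarrow> 'l) \<Rightarrow> 'v \<Rightarrow> 'l \<Rightarrow> 'l \<Rightarrow> real" where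
  "map_matrix p v i i' = (if p v i' = i then 1 else 0)"

text \<open>
  The linear map given by a family of square matrices \<open>P v\<close>: it sends the node block at \<open>v\<close>
  to \<open>P v\<close> times it, and multiplies the edge block at \<open>(u, v)\<close> by \<open>P u\<close> from the left
  and by the transpose of \<open>P v\<close> from the right.
\<close>

fun block_map ::
  "('v \<Rightarrow> 'l set) \<Rightarrow> ('v \<Rightarrow> 'l \<Rightarrow> 'l \<Rightarrow> real) \<Rightarrow> ('v, 'l) ivec \<Rightarrow> ('v, 'l) ivec" where
  "block_map X P \<mu> (NodeIx v i) = (\<Sum>i'\<in>X v. P v i i' * \<mu> (NodeIx v i'))"
| "block_map X P \<mu> (EdgeIx u v i j) =
     (\<Sum>i'\<in>X u. \<Sum>j'\<in>X v. P u i i' * \<mu> (EdgeIx u v i' j') * P v j j')"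

definition lin_ext ::
  "('v \<Rightarrow> 'l set) \<Rightarrow> ('v \<Rightarrow> 'l \<Rightarrow> 'l) \<Rightarrow> ('v, 'l) ivec \<Rightarrow> ('v, 'l) ivec" where
  "lin_ext X p = block_map X (map_matrix p)"

definition lin_ext_transpose ::
  "('v \<Rightarrow> 'l set) \<Rightarrow> ('v \<Rightarrow> 'l \<Rightarrow> 'l) \<Rightarrow> ('v, 'l) ivec \<Rightarrow> ('v, 'l) ivec" where
  "lin_ext_transpose X p = block_map X (\<lambda>v i i'. map_matrix p v i' i)"

text \<open>The operator just defined is the adjoint of \<open>lin_ext\<close> for the inner product \<open>energy\<close>.\<close>

lemma energy_lin_ext_transpose:
  "energy E X A (lin_ext_transpose X p \<theta>) \<mu> = energy E X A \<theta> (lin_ext X p \<mu>)"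
proof -
  let ?P = "map_matrix p"
  have node: "(\<Sum>i\<in>X v. lin_ext_transpose X p \<theta> (NodeIx v i) * \<mu> (NodeIx v i)) =
      (\<Sum>i\<in>X v. \<theta> (NodeIx v i) * lin_ext X p \<mu> (NodeIx v i))" for v
    unfolding lin_ext_def lin_ext_transpose_def block_map.simps sum_distrib_left sum_distrib_right
    by (subst sum.swap) (simp add: mult_ac)
  have edge: "(\<Sum>i\<in>X u. \<Sum>j\<in>X v. lin_ext_transpose X p \<theta> (EdgeIx u v i j) * \<mu> (EdgeIx u v i j)) =
      (\<Sum>i\<in>X u. \<Sum>j\<in>X v. \<theta> (EdgeIx u v i j) * lin_ext X p \<mu> (EdgeIx u v i j))" for u v
  proof -
    have "(\<Sum>i\<in>X u. \<Sum>j\<in>X v. lin_ext_transpose X p \<theta> (EdgeIx u v i j) * \<mu> (EdgeIx u v i j)) =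
        (\<Sum>k\<in>X u \<times> X v. \<Sum>k'\<in>X u \<times> X v.
          ?P u (fst k') (fst k) * \<theta> (EdgeIx u v (fst k') (snd k')) * ?P v (snd k') (snd k)
            * \<mu> (EdgeIx u v (fst k) (snd k)))"
      by (simp add: lin_ext_transpose_def sum.cartesian_product' sum_distrib_right)
    also have "\<dots> = (\<Sum>k'\<in>X u \<times> X v. \<Sum>k\<in>X u \<times> X v.
          ?P u (fst k') (fst k) * \<theta> (EdgeIx u v (fst k') (snd k')) * ?P v (snd k') (snd k)
            * \<mu> (EdgeIx u v (fst k) (snd k)))"
      by (rule sum.swap)
    also have "\<dots> = (\<Sum>i\<in>X u. \<Sum>j\<in>X v. \<theta> (EdgeIx u v i j) * lin_ext X p \<mu> (EdgeIx u v i j))"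
      by (simp add: lin_ext_def sum.cartesian_product' sum_distrib_left mult_ac)
    finally show ?thesis .
  qed
  show ?thesis
    by (simp only: energy_def node edge)
qed

definition improving_objective ::
  "'v set \<Rightarrow> 'v set set \<Rightarrow> ('v \<Rightarrow> 'l set) \<Rightarrow> ('v, 'l) ivec \<Rightarrow> ('v \<Rightarrow> 'l \<Rightarrow> 'l) \<Rightarrow>
   ('v, 'l) ivec \<Rightarrow> real" where
  "improving_objective V E X \<theta> p = energy E X V (\<theta> - lin_ext_transpose X p \<theta>)"

definition improving ::
  "'v set \<Rightarrow> 'v set set \<Rightarrow> ('v \<Rightarrow> 'l set) \<Rightarrow> ('v, 'l) ivec \<Rightarrow> ('v \<Rightarrow> 'l \<Rightarrow> 'l) \<Rightarrow> bool" where
  "improving V E X \<theta> p \<longleftrightarrow>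
     idempotent_map V X p \<and>
     (\<exists>\<mu>. is_arg_min (improving_objective V E X \<theta> p) (\<lambda>\<mu>. \<mu> \<in> local_polytope E X V) \<mu> \<and>
          improving_objective V E X \<theta> p \<mu> = 0)"

definition strictly_improving ::
  "'v set \<Rightarrow> 'v set set \<Rightarrow> ('v \<Rightarrow> 'l set) \<Rightarrow> ('v, 'l) ivec \<Rightarrow> ('v \<Rightarrow> 'l \<Rightarrow> 'l) \<Rightarrow> bool" where
  "strictly_improving V E X \<theta> p \<longleftrightarrow>
     improving V E X \<theta> p \<and>
     (\<forall>\<mu>. is_arg_min (improving_objective V E X \<theta> p) (\<lambda>\<mu>. \<mu> \<in> local_polytope E X V) \<mu> \<longrightarrow>
          lin_ext X p \<mu> = \<mu>)"

definition all_to_one :: "'v set \<Rightarrow> ('v \<Rightarrow> 'l) \<Rightarrow> 'v \<Rightarrow> 'l \<Rightarrow> 'l" where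
  "all_to_one A y v i = (if v \<in> A then y v else i)"

end

theory Submission
  imports Defs
begin

text \<open>
  After the reparametrization the row \<open>y u\<close> of every edge potential is constant.  Call \<open>y\<close> a strict
  minimizer on \<open>B\<close> if its indicator vector is the unique minimizer of the subproblem on \<open>B\<close> with test
  labeling \<open>y\<close>.  The boundary potentials bound the loss from fixing the labels in \<open>B\<close>, so a strict
  minimizer on \<open>B\<close> makes the all-to-one mapping strictly improving.  The converse holds because the bound
  is attained near \<open>y\<close>: with uniform marginals outside \<open>B\<close>, the small mass on the labels \<open>i \<noteq> y u\<close> can be
  sent to the minimizing partner labels while the constant rows absorb the rest at no cost.

  The same bound applied to the subproblem solutions shows that the algorithm keeps every \<open>B\<close> on
  which \<open>y\<close> is a strict minimizer.  In intermediate iterations the current labeling may differ from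
  \<open>y\<close> outside \<open>B\<close>, but not in the output: by uniqueness the output labeling is a strict minimizer on the
  output set, so fixing it strictly improves every vector that disagrees with it, and optimality of \<open>\<mu>0\<close> forces \<open>\<mu>0\<close> to agree
  with it.
\<close>

section \<open>Vectors, energies and indicator vectors\<close>

text \<open>The symmetry half of \<open>ivec_space\<close>. It is kept apart because this half
  survives reparametrization, whereas the messages can leave nonzero entries off the index
  set.\<close>

definition sym_ivec :: "('v, 'l) ivec \<Rightarrow> bool" where
  "sym_ivec \<theta> \<longleftrightarrow> (\<forall>u v i j. \<theta> (EdgeIx u v i j) = \<theta> (EdgeIx v u j i))"

definition pair_energy :: "('v \<Rightarrow> 'l set) \<Rightarrow> ('v, 'l) ivec \<Rightarrow> ('v, 'l) ivec \<Rightarrow> 'v \<Rightarrow> 'v \<Rightarrow> real" where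
  "pair_energy X \<theta> \<mu> u v = (\<Sum>i\<in>X u. \<Sum>j\<in>X v. \<theta> (EdgeIx u v i j) * \<mu> (EdgeIx u v i j))"

text \<open>Ordered pairs: every undirected edge occurs in both orientations, hence the halving in
  \<open>energy_alt\<close>.\<close>

definition inner_edges :: "'v set set \<Rightarrow> 'v set \<Rightarrow> ('v \<times> 'v) set" where
  "inner_edges E A = {(u, v). u \<in> A \<and> v \<in> A \<and> {u, v} \<in> E}"

definition restrict_ivec ::
  "'v set set \<Rightarrow> ('v \<Rightarrow> 'l set) \<Rightarrow> 'v set \<Rightarrow> ('v, 'l) ivec \<Rightarrow> ('v, 'l) ivec" where
  "restrict_ivec E X A \<mu> = (\<lambda>k. if k \<in> index_set E X A then \<mu> k else 0)"

fun delta :: "'v set set \<Rightarrow> 'v set \<Rightarrow> ('v \<Rightarrow> 'l) \<Rightarrow> ('v, 'l) ivec" where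
  "delta E A x (NodeIx v i) = of_bool (v \<in> A \<and> i = x v)"
| "delta E A x (EdgeIx u v i j) = of_bool (u \<in> A \<and> v \<in> A \<and> {u, v} \<in> E \<and> i = x u \<and> j = x v)"

lemma node_in_index_set [simp]: "NodeIx v i \<in> index_set E X A \<longleftrightarrow> v \<in> A \<and> i \<in> X v"
  by (auto simp: index_set_def)

lemma edge_in_index_set [simp]:
  "EdgeIx u v i j \<in> index_set E X A \<longleftrightarrow> u \<in> A \<and> v \<in> A \<and> {u, v} \<in> E \<and> i \<in> X u \<and> j \<in> X v"
  by (auto simp: index_set_def)

lemma sym_ivecD: "sym_ivec \<theta> \<Longrightarrow> \<theta> (EdgeIx u v i j) = \<theta> (EdgeIx v u j i)"
  by (simp add: sym_ivec_def)

lemma energy_alt: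
  "energy E X A \<theta> \<mu> = (\<Sum>v\<in>A. \<Sum>i\<in>X v. \<theta> (NodeIx v i) * \<mu> (NodeIx v i)) +
     (\<Sum>(u, v) \<in> inner_edges E A. pair_energy X \<theta> \<mu> u v) / 2"
  by (simp add: energy_def pair_energy_def inner_edges_def)

lemma pair_energy_commute:
  assumes "sym_ivec \<theta>" "sym_ivec \<mu>"
  shows "pair_energy X \<theta> \<mu> u v = pair_energy X \<theta> \<mu> v u"
  unfolding pair_energy_def
  by (subst sum.swap) (simp add: sym_ivecD[OF assms(1), of u v] sym_ivecD[OF assms(2), of u v])

lemma energy_cong:
  assumes "\<And>k. k \<in> index_set E X A \<Longrightarrow> \<mu> k = \<nu> k"
  shows "energy E X A \<theta> \<mu> = energy E X A \<theta> \<nu>"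
  unfolding energy_def
  by (intro arg_cong2[where f = "(+)"] arg_cong2[where f = "(/)"] sum.cong refl)
     (auto simp: assms intro!: sum.cong)

text \<open>The test labeling enters only through boundary edges, at their inner ends. So labelings
  that agree on the boundary define the same subproblem.\<close>

lemma hat_energy_cong:
  assumes "\<And>k. k \<in> index_set E X A \<Longrightarrow> \<mu> k = \<nu> k"
    and "\<And>u. u \<in> boundary_nodes V E A \<Longrightarrow> x u = y u"
  shows "hat_energy V E X A x \<theta> \<mu> = hat_energy V E X A y \<theta> \<nu>"
  unfolding hat_energy_def
proof (intro arg_cong2[where f = "(+)"] energy_cong assms(1) sum.cong refl, assumption)
  fix e assume e: "e \<in> boundary_edges V E A"
  then have "x (fst e) = y (fst e)" "fst e \<in> A"
    by (auto simp: boundary_edges_def boundary_nodes_def intro!: assms(2))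
  then show "(case e of (u, v) \<Rightarrow> \<Sum>i\<in>X u. hat_pot X \<theta> u v (x u) i * \<mu> (NodeIx u i)) =
      (case e of (u, v) \<Rightarrow> \<Sum>i\<in>X u. hat_pot X \<theta> u v (y u) i * \<nu> (NodeIx u i))"
    by (auto simp: assms(1) split: prod.splits intro!: sum.cong)
qed

lemma sum_mix:
  fixes f g :: "'a \<Rightarrow> real"
  shows "(\<Sum>x\<in>S. a * f x + b * g x) = a * sum f S + b * sum g S"
  by (simp add: sum.distrib sum_distrib_left)

lemma energy_mix:
  "energy E X A \<theta> (\<lambda>k. a * \<mu> k + b * \<nu> k) = a * energy E X A \<theta> \<mu> + b * energy E X A \<theta> \<nu>"
proof -
  have mult: "c * (a * s + b * t) = a * (c * s) + b * (c * t)" for c s t :: real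
    by algebra
  have half: "a * s + b * t + (a * s' + b * t') / 2 = a * (s + s' / 2) + b * (t + t' / 2)"
    for s s' t t' :: real
    by (simp add: field_simps)
  show ?thesis
    unfolding energy_def case_prod_unfold mult sum_mix half ..
qed

text \<open>Linearity in the vector: on the segment from an indicator vector to another vector the
  energy gap scales with the step length.\<close>

lemma hat_energy_mix:
  "hat_energy V E X A x \<theta> (\<lambda>k. a * \<mu> k + b * \<nu> k) =
     a * hat_energy V E X A x \<theta> \<mu> + b * hat_energy V E X A x \<theta> \<nu>"
proof -
  have mult: "c * (a * s + b * t) = a * (c * s) + b * (c * t)" for c s t :: real
    by algebra
  have "a * s + b * t + (a * s' + b * t') = a * (s + s') + b * (t + t')" for s s' t t' :: real
    by algebra
  then show ?thesis
    unfolding hat_energy_def energy_mix case_prod_unfold mult sum_mix .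
qed

lemma energy_diff_left: "energy E X A (\<theta> - \<theta>') \<mu> = energy E X A \<theta> \<mu> - energy E X A \<theta>' \<mu>"
proof -
  have half: "s - t + (s' - t') / 2 = (s + s' / 2) - (t + t' / 2)" for s s' t t' :: real
    by (simp add: field_simps)
  show ?thesis
    unfolding energy_def case_prod_unfold minus_apply left_diff_distrib sum_subtractf half ..
qed

lemma hat_energy_V [simp]: "hat_energy V E X V x \<theta> = energy E X V \<theta>"
  by (rule ext) (simp add: hat_energy_def boundary_edges_def)

text \<open>An edge leaving \<open>B\<close> ends either in \<open>A - B\<close> or outside
  \<open>A\<close>. In the subproblem on \<open>A\<close> the first kind carries pairwise terms,
  while the second kind is still a boundary edge.\<close>

lemma boundary_edges_split:
  assumes "B \<subseteq> A" "A \<subseteq> V"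
  shows "boundary_edges V E B = boundary_edges A E B \<union> {(u, v) \<in> boundary_edges V E A. u \<in> B}"
    and "boundary_edges A E B \<inter> {(u, v) \<in> boundary_edges V E A. u \<in> B} = {}"
  using assms by (auto simp: boundary_edges_def)

lemma sum_eq_one_others_zero:
  fixes f :: "'a \<Rightarrow> real"
  assumes "finite S" "sum f S = 1" "a \<in> S" "f a = 1" "\<And>i. 0 \<le> f i" "i \<in> S" "i \<noteq> a"
  shows "f i = 0"
proof -
  have "sum f (S - {a}) = 0"
    using assms by (simp add: sum_diff1)
  then show ?thesis
    using assms by (subst (asm) sum_nonneg_eq_0_iff) auto
qed

section \<open>The local polytope and its integral points\<close>

locale graphical_model =
  fixes V :: "'v set" and E :: "'v set set" and X :: "'v \<Rightarrow> 'l set"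
  assumes graph: "simple_graph V E"
    and labels: "\<And>v. v \<in> V \<Longrightarrow> finite (X v) \<and> X v \<noteq> {}"
begin

abbreviation polytope :: "'v set \<Rightarrow> ('v, 'l) ivec set" where
  "polytope \<equiv> local_polytope E X"

abbreviation fix_labels :: "'v set \<Rightarrow> ('v \<Rightarrow> 'l) \<Rightarrow> ('v, 'l) ivec \<Rightarrow> ('v, 'l) ivec" where
  "fix_labels B y \<equiv> lin_ext X (all_to_one B y)"

lemma finite_V: "finite V"
  using graph by (simp add: simple_graph_def)

lemma edgeD: "{u, v} \<in> E \<Longrightarrow> u \<in> V \<and> v \<in> V \<and> u \<noteq> v"
  using graph by (auto simp: simple_graph_def)

lemma finite_labels: "v \<in> V \<Longrightarrow> finite (X v)"
  using labels by blast

lemma finite_inner_edges: "finite (inner_edges E A)"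
  by (rule finite_subset[of _ "V \<times> V"]) (auto simp: inner_edges_def finite_V dest: edgeD)

lemma finite_boundary_edges: "finite (boundary_edges A E B)"
  by (rule finite_subset[of _ "V \<times> V"]) (auto simp: boundary_edges_def finite_V dest: edgeD)

lemma polytopeD:
  assumes "\<mu> \<in> polytope A"
  shows "k \<notin> index_set E X A \<Longrightarrow> \<mu> k = 0" "sym_ivec \<mu>" "0 \<le> \<mu> k"
    and "v \<in> A \<Longrightarrow> (\<Sum>i\<in>X v. \<mu> (NodeIx v i)) = 1"
    and "\<lbrakk>u \<in> A; v \<in> A; {u, v} \<in> E; i \<in> X u\<rbrakk> \<Longrightarrow> (\<Sum>j\<in>X v. \<mu> (EdgeIx u v i j)) = \<mu> (NodeIx u i)"
    and "\<lbrakk>u \<in> A; v \<in> A; {u, v} \<in> E; j \<in> X v\<rbrakk> \<Longrightarrow> (\<Sum>i\<in>X u. \<mu> (EdgeIx u v i j)) = \<mu> (NodeIx v j)"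
  using assms unfolding local_polytope_def ivec_space_def sym_ivec_def by blast+

text \<open>By symmetry only one of the two marginalization constraints has to be checked.\<close>

lemma polytopeI:
  assumes "\<And>k. k \<notin> index_set E X A \<Longrightarrow> \<mu> k = 0" "sym_ivec \<mu>" "\<And>k. 0 \<le> \<mu> k"
    and "\<And>v. v \<in> A \<Longrightarrow> (\<Sum>i\<in>X v. \<mu> (NodeIx v i)) = 1"
    and "\<And>u v i. \<lbrakk>u \<in> A; v \<in> A; {u, v} \<in> E; i \<in> X u\<rbrakk> \<Longrightarrow>
           (\<Sum>j\<in>X v. \<mu> (EdgeIx u v i j)) = \<mu> (NodeIx u i)"
  shows "\<mu> \<in> polytope A"
proof -
  have "(\<Sum>i\<in>X u. \<mu> (EdgeIx u v i j)) = \<mu> (NodeIx v j)"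
    if "u \<in> A" "v \<in> A" "{u, v} \<in> E" "j \<in> X v" for u v j
    using assms(5)[of v u j] that by (simp add: sym_ivecD[OF assms(2), of u v] insert_commute)
  then show ?thesis
    unfolding local_polytope_def ivec_space_def
    by (intro CollectI conjI allI ballI impI) (simp_all add: assms(1,3-5) sym_ivecD[OF assms(2)])
qed

lemma restrict_in_polytope:
  assumes "\<mu> \<in> polytope A" "B \<subseteq> A"
  shows "restrict_ivec E X B \<mu> \<in> polytope B"
proof (rule polytopeI)
  show "sym_ivec (restrict_ivec E X B \<mu>)"
    using polytopeD(2)[OF assms(1)] by (auto simp: sym_ivec_def restrict_ivec_def insert_commute)
qed (use assms(2) in \<open>auto simp: restrict_ivec_def polytopeD(3-5)[OF assms(1)] subset_iff cong: sum.cong\<close>)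

lemma polytope_mix:
  assumes "\<mu> \<in> polytope A" "\<nu> \<in> polytope A" "0 \<le> a" "0 \<le> b" "a + b = 1"
  shows "(\<lambda>k. a * \<mu> k + b * \<nu> k) \<in> polytope A"
proof (rule polytopeI)
  show "sym_ivec (\<lambda>k. a * \<mu> k + b * \<nu> k)"
    using polytopeD(2)[OF assms(1)] polytopeD(2)[OF assms(2)] by (auto simp: sym_ivec_def)
qed (use assms in \<open>simp_all add: polytopeD[OF assms(1)] polytopeD[OF assms(2)] sum_mix\<close>)

lemma delta_in_polytope:
  assumes "A \<subseteq> V" "\<And>v. v \<in> A \<Longrightarrow> x v \<in> X v"
  shows "delta E A x \<in> polytope A"
proof (rule polytopeI)
  show "delta E A x k = 0" if "k \<notin> index_set E X A" for k
    using that assms(2) by (cases k) auto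
  show "sym_ivec (delta E A x)"
    by (auto simp: sym_ivec_def insert_commute)
  show "0 \<le> delta E A x k" for k
    by (cases k) auto
  show "(\<Sum>i\<in>X v. delta E A x (NodeIx v i)) = 1" if "v \<in> A" for v
    using that assms finite_labels[of v] by (auto simp: of_bool_def)
  show "(\<Sum>j\<in>X v. delta E A x (EdgeIx u v i j)) = delta E A x (NodeIx u i)"
    if "u \<in> A" "v \<in> A" "{u, v} \<in> E" "i \<in> X u" for u v i
    using that assms finite_labels[of v] by (cases "i = x u") (auto simp: of_bool_def)
qed

lemma node_of_integral:
  assumes \<mu>: "\<mu> \<in> polytope A" and "A \<subseteq> V" "v \<in> A" "\<mu> (NodeIx v a) = 1"
  shows "\<mu> (NodeIx v i) = of_bool (i = a)"
proof (cases "i \<in> X v \<and> i \<noteq> a")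
  case True
  have "a \<in> X v"
    using polytopeD(1)[OF \<mu>, of "NodeIx v a"] assms(4) by auto
  then have "\<mu> (NodeIx v i) = 0"
    by (intro sum_eq_one_others_zero[of "X v" "\<lambda>i. \<mu> (NodeIx v i)" a])
       (use assms True finite_labels[of v] polytopeD[OF \<mu>] in auto)
  with True show ?thesis by simp
next
  case False
  then show ?thesis
    using polytopeD(1)[OF \<mu>, of "NodeIx v i"] assms(4) by auto
qed

text \<open>A point mass at one end leaves a single nonzero row, and the column constraint
  determines it: the block is the product of the two marginals.\<close>

lemma edge_of_integral:
  assumes \<mu>: "\<mu> \<in> polytope A" and "A \<subseteq> V" "u \<in> A" "v \<in> A" "{u, v} \<in> E" "\<mu> (NodeIx u a) = 1"
  shows "\<mu> (EdgeIx u v i j) = of_bool (i = a) * \<mu> (NodeIx v j)"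
proof (cases "j \<in> X v")
  case True
  have fin: "finite (X u)" "finite (X v)" and a: "a \<in> X u"
    using assms finite_labels polytopeD(1)[OF \<mu>, of "NodeIx u a"] by auto
  have off: "\<mu> (EdgeIx u v i j) = 0" if "i \<noteq> a" for i
  proof (cases "i \<in> X u")
    case i: True
    have "(\<Sum>j\<in>X v. \<mu> (EdgeIx u v i j)) = 0"
      using assms that i by (simp add: polytopeD(5)[OF \<mu>] node_of_integral[OF \<mu>])
    then show ?thesis
      using fin True by (subst (asm) sum_nonneg_eq_0_iff) (auto simp: polytopeD(3)[OF \<mu>])
  qed (simp add: polytopeD(1)[OF \<mu>])
  have "\<mu> (NodeIx v j) = (\<Sum>i\<in>X u. \<mu> (EdgeIx u v i j))"
    using assms True by (simp add: polytopeD(6)[OF \<mu>])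
  also have "\<dots> = (\<Sum>i\<in>X u. if i = a then \<mu> (EdgeIx u v a j) else 0)"
    by (rule sum.cong) (auto simp: off)
  finally show ?thesis
    using off fin a by auto
qed (simp add: polytopeD(1)[OF \<mu>])

text \<open>Integral node marginals determine the edge blocks, so one entry per node has to be
  checked.\<close>

lemma eq_deltaI:
  assumes \<mu>: "\<mu> \<in> polytope A" and A: "A \<subseteq> V" and one: "\<And>v. v \<in> A \<Longrightarrow> \<mu> (NodeIx v (x v)) = 1"
  shows "\<mu> = delta E A x"
proof
  fix k show "\<mu> k = delta E A x k"
  proof (cases k)
    case (NodeIx v i)
    then show ?thesis
      using polytopeD(1)[OF \<mu>, of k] by (cases "v \<in> A") (auto simp: node_of_integral[OF \<mu> A _ one])
  next
    case (EdgeIx u v i j)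
    then show ?thesis
      using polytopeD(1)[OF \<mu>, of k]
      by (cases "u \<in> A \<and> v \<in> A \<and> {u, v} \<in> E")
         (auto simp: edge_of_integral[OF \<mu> A _ _ _ one] node_of_integral[OF \<mu> A _ one])
  qed
qed

section \<open>The linear extension of an all-to-one mapping\<close>

lemma fix_labels_node:
  assumes "\<mu> \<in> polytope A" "A \<subseteq> V" "v \<in> A" "\<And>v. v \<in> B \<Longrightarrow> y v \<in> X v"
  shows "fix_labels B y \<mu> (NodeIx v i) = (if v \<in> B then of_bool (i = y v) else \<mu> (NodeIx v i))"
proof (cases "v \<in> B")
  case True
  then show ?thesis
    using polytopeD(4)[OF assms(1), of v] assms(3)
    by (auto simp: lin_ext_def map_matrix_def all_to_one_def)
next
  case False
  then show ?thesis
    using finite_labels[of v] assms polytopeD(1)[OF assms(1), of "NodeIx v i"]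
    by (auto simp: lin_ext_def map_matrix_def all_to_one_def if_distrib[of "\<lambda>a. a * _"] cong: if_cong)
qed

text \<open>Fixing one end of an edge sums out its labels and leaves a point mass times the marginal
  of the other end; with both ends fixed only the total mass one remains.\<close>

lemma fix_labels_edge:
  assumes "\<mu> \<in> polytope A" "A \<subseteq> V" "u \<in> A" "v \<in> A" "{u, v} \<in> E" "\<And>v. v \<in> B \<Longrightarrow> y v \<in> X v"
  shows "fix_labels B y \<mu> (EdgeIx u v i j) =
    (if u \<in> B then if v \<in> B then of_bool (i = y u \<and> j = y v)
                   else of_bool (i = y u) * \<mu> (NodeIx v j)
     else if v \<in> B then of_bool (j = y v) * \<mu> (NodeIx u i) else \<mu> (EdgeIx u v i j))"
proof -
  have fin: "finite (X u)" "finite (X v)"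
    using assms finite_labels by auto
  have zero: "\<mu> (NodeIx u i) = 0" if "i \<notin> X u" for i
    by (rule polytopeD(1)[OF assms(1)]) (use that in auto)
  have zero': "\<mu> (NodeIx v j) = 0" if "j \<notin> X v" for j
    by (rule polytopeD(1)[OF assms(1)]) (use that in auto)
  have zero'': "\<mu> (EdgeIx u v i j) = 0" if "i \<notin> X u \<or> j \<notin> X v" for i j
    by (rule polytopeD(1)[OF assms(1)]) (use that in auto)
  have tot: "(\<Sum>i\<in>X u. \<Sum>j\<in>X v. \<mu> (EdgeIx u v i j)) = 1"
    using assms by (simp add: polytopeD)
  have col: "(\<Sum>i\<in>X u. \<mu> (EdgeIx u v i j)) = \<mu> (NodeIx v j)" if "j \<in> X v"
    using assms that by (simp add: polytopeD)
  have row: "(\<Sum>j\<in>X v. \<mu> (EdgeIx u v i j)) = \<mu> (NodeIx u i)" if "i \<in> X u"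
    using assms that by (simp add: polytopeD)
  show ?thesis
  proof (cases "u \<in> B"; cases "v \<in> B")
    assume "u \<in> B" "v \<in> B"
    then show ?thesis
      using tot by (auto simp: lin_ext_def map_matrix_def all_to_one_def)
  next
    assume B: "u \<in> B" "v \<notin> B"
    have "fix_labels B y \<mu> (EdgeIx u v i j) =
        of_bool (i = y u) * (\<Sum>i'\<in>X u. \<Sum>j'\<in>X v. if j' = j then \<mu> (EdgeIx u v i' j) else 0)"
      using B by (auto simp: lin_ext_def map_matrix_def all_to_one_def intro!: sum.cong)
    then show ?thesis
      using B fin col zero' zero'' by (cases "j \<in> X v") auto
  next
    assume B: "u \<notin> B" "v \<in> B"
    have "fix_labels B y \<mu> (EdgeIx u v i j) =
        of_bool (j = y v) * (\<Sum>i'\<in>X u. if i' = i then \<Sum>j'\<in>X v. \<mu> (EdgeIx u v i j') else 0)"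
      using B by (auto simp: lin_ext_def map_matrix_def all_to_one_def intro!: sum.cong)
    then show ?thesis
      using B fin row zero zero'' by (cases "i \<in> X u") auto
  next
    assume B: "u \<notin> B" "v \<notin> B"
    have "fix_labels B y \<mu> (EdgeIx u v i j) =
        (\<Sum>i'\<in>X u. if i' = i then \<Sum>j'\<in>X v. if j' = j then \<mu> (EdgeIx u v i j) else 0 else 0)"
      using B by (auto simp: lin_ext_def map_matrix_def all_to_one_def intro!: sum.cong)
    then show ?thesis
      using B fin zero'' by auto
  qed
qed

lemma fix_labels_outside:
  assumes \<mu>: "\<mu> \<in> polytope A" and A: "A \<subseteq> V" and y: "\<And>v. v \<in> B \<Longrightarrow> y v \<in> X v"
    and k: "k \<notin> index_set E X A"
  shows "fix_labels B y \<mu> k = 0"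
proof (cases k)
  case (NodeIx v i)
  show ?thesis
  proof (cases "v \<in> A")
    case True
    then show ?thesis
      using NodeIx k y fix_labels_node[OF \<mu> A True y] polytopeD(1)[OF \<mu>, of k] by auto
  next
    case False
    then show ?thesis
      using NodeIx by (simp add: lin_ext_def polytopeD(1)[OF \<mu>])
  qed
next
  case (EdgeIx u v i j)
  show ?thesis
  proof (cases "u \<in> A \<and> v \<in> A \<and> {u, v} \<in> E")
    case True
    then show ?thesis
      using EdgeIx k y fix_labels_edge[OF \<mu> A _ _ _ y, of u v] polytopeD(1)[OF \<mu>]
      by (auto simp: of_bool_def)
  next
    case False
    then show ?thesis
      using EdgeIx by (auto simp: lin_ext_def polytopeD(1)[OF \<mu>])
  qed
qed

text \<open>Edge blocks meeting \<open>B\<close> become products of node marginals and so satisfy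
  the marginalization constraints. This makes the fixed vector an admissible competitor in the
  minimizations.\<close>

lemma fix_labels_in_polytope:
  assumes \<mu>: "\<mu> \<in> polytope A" and A: "A \<subseteq> V" and y: "\<And>v. v \<in> B \<Longrightarrow> y v \<in> X v"
  shows "fix_labels B y \<mu> \<in> polytope A"
proof (rule polytopeI)
  note node = fix_labels_node[OF \<mu> A _ y] and edge = fix_labels_edge[OF \<mu> A _ _ _ y]
  note outside = fix_labels_outside[OF \<mu> A y]
  show "fix_labels B y \<mu> k = 0" if "k \<notin> index_set E X A" for k
    using that by (simp add: outside)
  show "sym_ivec (fix_labels B y \<mu>)"
    unfolding sym_ivec_def
  proof (intro allI)
    fix u v i j
    show "fix_labels B y \<mu> (EdgeIx u v i j) = fix_labels B y \<mu> (EdgeIx v u j i)"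
    proof (cases "u \<in> A \<and> v \<in> A \<and> {u, v} \<in> E")
      case True
      then show ?thesis
        using sym_ivecD[OF polytopeD(2)[OF \<mu>], of u v i j] by (auto simp: edge insert_commute)
    next
      case False
      then have "EdgeIx u v i j \<notin> index_set E X A" "EdgeIx v u j i \<notin> index_set E X A"
        by (auto simp: insert_commute)
      then show ?thesis by (simp add: outside)
    qed
  qed
  show "0 \<le> fix_labels B y \<mu> k" for k
  proof (cases "k \<in> index_set E X A")
    case True
    then show ?thesis
      by (cases k) (auto simp: node edge polytopeD(3)[OF \<mu>])
  qed (simp add: outside)
  show "(\<Sum>i\<in>X v. fix_labels B y \<mu> (NodeIx v i)) = 1" if "v \<in> A" for v
    using that A y finite_labels[of v]
    by (cases "v \<in> B") (auto simp: node polytopeD(4)[OF \<mu>] of_bool_def)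
  show "(\<Sum>j\<in>X v. fix_labels B y \<mu> (EdgeIx u v i j)) = fix_labels B y \<mu> (NodeIx u i)"
    if uv: "u \<in> A" "v \<in> A" "{u, v} \<in> E" "i \<in> X u" for u v i
  proof -
    have "finite (X v)" using A uv finite_labels by auto
    then show ?thesis
      using uv y
      by (cases "u \<in> B"; cases "v \<in> B"; cases "i = y u")
         (simp_all add: node edge polytopeD(4,5)[OF \<mu>] of_bool_def flip: sum_distrib_right)
  qed
qed

text \<open>Where \<mu> is integral at \<open>y\<close>, its edge blocks are already the products
  that fixing would produce.\<close>

lemma fix_labels_id:
  assumes \<mu>: "\<mu> \<in> polytope A" and A: "A \<subseteq> V" and y: "\<And>v. v \<in> B \<Longrightarrow> y v \<in> X v"
    and one: "\<And>v. v \<in> A \<Longrightarrow> v \<in> B \<Longrightarrow> \<mu> (NodeIx v (y v)) = 1"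
  shows "fix_labels B y \<mu> = \<mu>"
proof
  fix k show "fix_labels B y \<mu> k = \<mu> k"
  proof (cases "k \<in> index_set E X A")
    case True
    show ?thesis
    proof (cases k)
      case (NodeIx v i)
      then show ?thesis
        using True by (auto simp: fix_labels_node[OF \<mu> A _ y] node_of_integral[OF \<mu> A _ one])
    next
      case (EdgeIx u v i j)
      \<comment> \<open>The integral end may be the second one; transposing reduces this case to
        \<open>edge_of_integral\<close>.\<close>
      have "\<mu> (EdgeIx u v i j) = \<mu> (EdgeIx v u j i)"
        by (rule sym_ivecD[OF polytopeD(2)[OF \<mu>]])
      with EdgeIx show ?thesis
        using True
        by (auto simp: fix_labels_edge[OF \<mu> A _ _ _ y] edge_of_integral[OF \<mu> A _ _ _ one]
              node_of_integral[OF \<mu> A _ one] insert_commute)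
    qed
  qed (simp add: fix_labels_outside[OF \<mu> A y] polytopeD(1)[OF \<mu>])
qed

section \<open>Energy change caused by fixing labels\<close>

lemma energy_split:
  assumes BA: "B \<subseteq> A" and A: "A \<subseteq> V" and sym: "sym_ivec \<theta>" "sym_ivec \<mu>"
  shows "energy E X A \<theta> \<mu> = energy E X B \<theta> \<mu> + energy E X (A - B) \<theta> \<mu> +
    (\<Sum>(u, v)\<in>boundary_edges A E B. pair_energy X \<theta> \<mu> u v)"
proof -
  let ?S = "\<lambda>R. \<Sum>(u, v)\<in>R. pair_energy X \<theta> \<mu> u v"
  let ?D = "boundary_edges A E B"
  have nodes: "(\<Sum>v\<in>A. \<Sum>i\<in>X v. \<theta> (NodeIx v i) * \<mu> (NodeIx v i)) =
      (\<Sum>v\<in>B. \<Sum>i\<in>X v. \<theta> (NodeIx v i) * \<mu> (NodeIx v i)) +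
      (\<Sum>v\<in>A - B. \<Sum>i\<in>X v. \<theta> (NodeIx v i) * \<mu> (NodeIx v i))"
    using BA finite_subset[OF A finite_V] by (simp add: sum.subset_diff[of B A] add.commute)
  \<comment> \<open>A crossing edge is listed once in \<open>boundary_edges\<close> but in both
    orientations in \<open>inner_edges\<close>. The two copies have equal energy, which compensates
    the factor one half.\<close>
  have swap: "?S (prod.swap ` ?D) = ?S ?D"
    by (subst sum.reindex) (auto simp: case_prod_unfold pair_energy_commute[OF sym])
  have "inner_edges E A = (inner_edges E B \<union> inner_edges E (A - B)) \<union> (?D \<union> prod.swap ` ?D)"
    using BA by (force simp: inner_edges_def boundary_edges_def insert_commute)
  also have "?S \<dots> = ?S (inner_edges E B \<union> inner_edges E (A - B)) + ?S (?D \<union> prod.swap ` ?D)"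
    by (rule sum.union_disjoint)
       (auto simp: finite_inner_edges finite_boundary_edges, auto simp: inner_edges_def boundary_edges_def)
  also have "?S (inner_edges E B \<union> inner_edges E (A - B)) = ?S (inner_edges E B) + ?S (inner_edges E (A - B))"
    by (rule sum.union_disjoint) (auto simp: finite_inner_edges, auto simp: inner_edges_def)
  also have "?S (?D \<union> prod.swap ` ?D) = ?S ?D + ?S (prod.swap ` ?D)"
    by (rule sum.union_disjoint) (auto simp: finite_boundary_edges, auto simp: boundary_edges_def)
  finally show ?thesis
    unfolding energy_alt nodes swap by (simp add: add_divide_distrib)
qed

text \<open>Replacing label \<open>i\<close> by \<open>a\<close> saves at least the difference of
  the hat potentials for each partner label: for \<open>i \<noteq> a\<close> the minimum of row
  \<open>i\<close> is compared with the maximum of row \<open>a\<close>, and for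
  \<open>i = a\<close> both sides vanish. Averaging over the edge block gives the bound.\<close>

lemma edge_bound:
  assumes \<mu>: "\<mu> \<in> polytope A" and A: "A \<subseteq> V" and uv: "u \<in> A" "v \<in> A" "{u, v} \<in> E" and a: "a \<in> X u"
  shows "(\<Sum>i\<in>X u. hat_pot X \<theta> u v a i * \<mu> (NodeIx u i)) - hat_pot X \<theta> u v a a \<le>
    pair_energy X \<theta> \<mu> u v - (\<Sum>j\<in>X v. \<theta> (EdgeIx u v a j) * \<mu> (NodeIx v j))"
proof -
  let ?h = "hat_pot X \<theta> u v a"
  have fin: "finite (X v)" using A uv finite_labels by auto
  have "(\<Sum>i\<in>X u. ?h i * \<mu> (NodeIx u i)) - ?h a = (\<Sum>i\<in>X u. (?h i - ?h a) * \<mu> (NodeIx u i))"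
    using uv by (simp add: left_diff_distrib sum_subtractf polytopeD(4)[OF \<mu>] flip: sum_distrib_left)
  also have "\<dots> = (\<Sum>i\<in>X u. \<Sum>j\<in>X v. (?h i - ?h a) * \<mu> (EdgeIx u v i j))"
    using uv by (simp add: polytopeD(5)[OF \<mu>] flip: sum_distrib_left)
  also have "\<dots> \<le> (\<Sum>i\<in>X u. \<Sum>j\<in>X v. (\<theta> (EdgeIx u v i j) - \<theta> (EdgeIx u v a j)) * \<mu> (EdgeIx u v i j))"
  proof (intro sum_mono mult_right_mono polytopeD(3)[OF \<mu>])
    fix i j assume "i \<in> X u" "j \<in> X v"
    then show "?h i - ?h a \<le> \<theta> (EdgeIx u v i j) - \<theta> (EdgeIx u v a j)"
      using fin by (auto simp: hat_pot_def intro!: diff_mono Min_le Max_ge)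
  qed
  also have "\<dots> = pair_energy X \<theta> \<mu> u v - (\<Sum>i\<in>X u. \<Sum>j\<in>X v. \<theta> (EdgeIx u v a j) * \<mu> (EdgeIx u v i j))"
    by (simp add: pair_energy_def left_diff_distrib sum_subtractf)
  also have "(\<Sum>i\<in>X u. \<Sum>j\<in>X v. \<theta> (EdgeIx u v a j) * \<mu> (EdgeIx u v i j)) =
      (\<Sum>j\<in>X v. \<theta> (EdgeIx u v a j) * \<mu> (NodeIx v j))"
    using uv by (subst sum.swap) (simp add: polytopeD(6)[OF \<mu>] flip: sum_distrib_left)
  finally show ?thesis .
qed

text \<open>Fixing replaces the block on \<open>B\<close> by an indicator vector and leaves the
  block on \<open>A - B\<close> alone. A crossing edge then reads only row \<open>x u\<close>,
  weighted by the marginal of its outer end.\<close>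

lemma energy_fix_labels_diff:
  assumes \<mu>: "\<mu> \<in> polytope A" and BA: "B \<subseteq> A" and A: "A \<subseteq> V" and x: "\<And>v. v \<in> B \<Longrightarrow> x v \<in> X v"
    and \<theta>: "sym_ivec \<theta>"
  shows "energy E X A \<theta> \<mu> - energy E X A \<theta> (fix_labels B x \<mu>) =
    energy E X B \<theta> \<mu> - energy E X B \<theta> (delta E B x) +
    (\<Sum>(u, v)\<in>boundary_edges A E B.
       pair_energy X \<theta> \<mu> u v - (\<Sum>j\<in>X v. \<theta> (EdgeIx u v (x u) j) * \<mu> (NodeIx v j)))"
proof -
  let ?\<nu> = "fix_labels B x \<mu>"
  note node = fix_labels_node[OF \<mu> A _ x] and edge = fix_labels_edge[OF \<mu> A _ _ _ x]
  have inner: "energy E X B \<theta> ?\<nu> = energy E X B \<theta> (delta E B x)"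
  proof (rule energy_cong)
    fix k assume "k \<in> index_set E X B"
    then show "?\<nu> k = delta E B x k"
      using BA by (cases k) (auto simp: node edge subset_iff)
  qed
  have outer: "energy E X (A - B) \<theta> ?\<nu> = energy E X (A - B) \<theta> \<mu>"
  proof (rule energy_cong)
    fix k assume "k \<in> index_set E X (A - B)"
    then show "?\<nu> k = \<mu> k"
      by (cases k) (auto simp: node edge)
  qed
  have bd: "(\<Sum>(u, v)\<in>boundary_edges A E B. pair_energy X \<theta> ?\<nu> u v) =
      (\<Sum>(u, v)\<in>boundary_edges A E B. \<Sum>j\<in>X v. \<theta> (EdgeIx u v (x u) j) * \<mu> (NodeIx v j))"
  proof (rule sum.cong[OF refl], clarify)
    fix u v assume "(u, v) \<in> boundary_edges A E B"
    then have uv: "u \<in> B" "u \<in> A" "v \<in> A" "v \<notin> B" "{u, v} \<in> E"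
      using BA by (auto simp: boundary_edges_def)
    have "pair_energy X \<theta> ?\<nu> u v =
        (\<Sum>i\<in>X u. if i = x u then \<Sum>j\<in>X v. \<theta> (EdgeIx u v (x u) j) * \<mu> (NodeIx v j) else 0)"
      unfolding pair_energy_def using uv by (intro sum.cong) (auto simp: edge)
    then show "pair_energy X \<theta> ?\<nu> u v = (\<Sum>j\<in>X v. \<theta> (EdgeIx u v (x u) j) * \<mu> (NodeIx v j))"
      using uv x A finite_labels[of u] by auto
  qed
  have "?\<nu> \<in> polytope A"
    by (intro fix_labels_in_polytope \<mu> A x)
  then show ?thesis
    using energy_split[OF BA A \<theta> polytopeD(2)[OF \<mu>]] energy_split[OF BA A \<theta> polytopeD(2)]
    by (simp add: inner outer bd[unfolded case_prod_unfold] case_prod_unfold sum_subtractf)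
qed

text \<open>Comparison of two nested subproblems. Crossing edges inside \<open>A\<close> are bounded
  by \<open>edge_bound\<close>, boundary edges of \<open>A\<close> starting in \<open>B\<close>
  contribute equally to both sides, and those starting off \<open>B\<close> cancel. The separate
  labeling \<open>x'\<close> accounts for the current labeling of a run, which may differ off
  \<open>B\<close>.\<close>

lemma hat_energy_fix_labels:
  assumes \<mu>: "\<mu> \<in> polytope A" and BA: "B \<subseteq> A" and A: "A \<subseteq> V" and x: "\<And>v. v \<in> B \<Longrightarrow> x v \<in> X v"
    and \<theta>: "sym_ivec \<theta>" and x': "\<And>v. v \<in> B \<Longrightarrow> x' v = x v"
  shows "hat_energy V E X B x \<theta> \<mu> - hat_energy V E X B x \<theta> (delta E B x) \<le>
    hat_energy V E X A x' \<theta> \<mu> - hat_energy V E X A x' \<theta> (fix_labels B x \<mu>)"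
proof -
  let ?\<nu> = "fix_labels B x \<mu>"
  let ?h = "\<lambda>x \<mu> (u, v). \<Sum>i\<in>X u. hat_pot X \<theta> u v (x u) i * \<mu> (NodeIx u i)"
  let ?R = "{(u, v) \<in> boundary_edges V E A. u \<in> B}"
  let ?D = "boundary_edges A E B"
  note node = fix_labels_node[OF \<mu> A _ x]
  have h_delta: "?h x (delta E B x) (u, v) = hat_pot X \<theta> u v (x u) (x u)" if "u \<in> B" for u v
  proof -
    have "finite (X u)" "x u \<in> X u"
      using that x BA A finite_labels by auto
    then show ?thesis
      using that by (simp add: of_bool_def if_distrib[of "(*) _"] cong: if_cong)
  qed
  have split: "sum f (boundary_edges V E B) = sum f ?D + sum f ?R" for f :: "'v \<times> 'v \<Rightarrow> real"
    unfolding boundary_edges_split(1)[OF BA A]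
    by (rule sum.union_disjoint[OF _ _ boundary_edges_split(2)[OF BA A]])
       (auto simp: finite_boundary_edges intro: finite_subset[OF _ finite_boundary_edges[of V A]])
  have outer: "sum (?h x' \<mu>) (boundary_edges V E A) - sum (?h x' ?\<nu>) (boundary_edges V E A) =
      sum (?h x \<mu>) ?R - sum (?h x (delta E B x)) ?R"
    unfolding sum_subtractf[symmetric]
  proof (rule sum.mono_neutral_cong_right)
    show "\<forall>e\<in>boundary_edges V E A - ?R. ?h x' \<mu> e - ?h x' ?\<nu> e = 0"
    proof
      fix e assume "e \<in> boundary_edges V E A - ?R"
      then obtain u v where "e = (u, v)" "u \<in> A" "u \<notin> B"
        by (auto simp: boundary_edges_def)
      then show "?h x' \<mu> e - ?h x' ?\<nu> e = 0"
        by (simp add: node)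
    qed
    fix e assume "e \<in> ?R"
    then show "?h x' \<mu> e - ?h x' ?\<nu> e = ?h x \<mu> e - ?h x (delta E B x) e"
      using BA by (auto simp: boundary_edges_def node x')
  qed (auto simp: finite_boundary_edges)
  have inner: "sum (?h x \<mu>) ?D - sum (?h x (delta E B x)) ?D \<le>
      (\<Sum>(u, v)\<in>?D. pair_energy X \<theta> \<mu> u v - (\<Sum>j\<in>X v. \<theta> (EdgeIx u v (x u) j) * \<mu> (NodeIx v j)))"
    unfolding sum_subtractf[symmetric]
  proof (rule sum_mono)
    fix e assume "e \<in> ?D"
    then obtain u v where e: "e = (u, v)" and uv: "u \<in> B" "u \<in> A" "v \<in> A" "{u, v} \<in> E"
      using BA by (auto simp: boundary_edges_def)
    show "?h x \<mu> e - ?h x (delta E B x) e \<le> (case e of (u, v) \<Rightarrow> pair_energy X \<theta> \<mu> u v -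
        (\<Sum>j\<in>X v. \<theta> (EdgeIx u v (x u) j) * \<mu> (NodeIx v j)))"
      using edge_bound[OF \<mu> A uv(2-4) x[OF uv(1)]] h_delta[OF uv(1)] unfolding e by simp
  qed
  have "energy E X A \<theta> \<mu> - energy E X A \<theta> ?\<nu> = energy E X B \<theta> \<mu> - energy E X B \<theta> (delta E B x) +
    (\<Sum>(u, v)\<in>?D. pair_energy X \<theta> \<mu> u v - (\<Sum>j\<in>X v. \<theta> (EdgeIx u v (x u) j) * \<mu> (NodeIx v j)))"
    by (rule energy_fix_labels_diff[OF \<mu> BA A x \<theta>])
  then show ?thesis
    using outer inner unfolding hat_energy_def split by linarith
qed

section \<open>Strict minimizers of a subproblem\<close>

text \<open>Stating that the sublevel set contains at most the indicator vector expresses minimality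
  and uniqueness at once.\<close>

definition strict_min :: "('v, 'l) ivec \<Rightarrow> 'v set \<Rightarrow> ('v \<Rightarrow> 'l) \<Rightarrow> bool" where
  "strict_min \<theta> B x \<longleftrightarrow> (\<forall>\<mu>\<in>polytope B.
     hat_energy V E X B x \<theta> \<mu> \<le> hat_energy V E X B x \<theta> (delta E B x) \<longrightarrow> \<mu> = delta E B x)"

text \<open>If fixing \<open>B\<close> does not lower the energy on \<open>A\<close>, then
  \<open>hat_energy_fix_labels\<close> puts the restriction of \<mu> into the sublevel set on
  \<open>B\<close>, so it is the indicator vector.\<close>

lemma strict_min_integral:
  assumes \<mu>: "\<mu> \<in> polytope A" and BA: "B \<subseteq> A" and A: "A \<subseteq> V" and x: "\<And>v. v \<in> B \<Longrightarrow> x v \<in> X v"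
    and \<theta>: "sym_ivec \<theta>" and x': "\<And>v. v \<in> B \<Longrightarrow> x' v = x v" and min: "strict_min \<theta> B x"
    and le: "hat_energy V E X A x' \<theta> \<mu> \<le> hat_energy V E X A x' \<theta> (fix_labels B x \<mu>)"
    and v: "v \<in> B"
  shows "\<mu> (NodeIx v (x v)) = 1"
proof -
  let ?\<nu> = "restrict_ivec E X B \<mu>"
  have "hat_energy V E X B x \<theta> ?\<nu> = hat_energy V E X B x \<theta> \<mu>"
    by (rule hat_energy_cong) (simp_all add: restrict_ivec_def)
  then have "?\<nu> = delta E B x"
    using hat_energy_fix_labels[OF \<mu> BA A x \<theta> x'] le restrict_in_polytope[OF \<mu> BA] min
    by (auto simp: strict_min_def)
  then have "?\<nu> (NodeIx v (x v)) = 1"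
    using v by simp
  then show ?thesis
    by (simp add: restrict_ivec_def split: if_splits)
qed

text \<open>If fixing raised the energy, \<mu> would already carry the fixed labels and would not
  change at all.\<close>

lemma strict_min_fix_labels_le:
  assumes "\<mu> \<in> polytope A" "B \<subseteq> A" "A \<subseteq> V" "\<And>v. v \<in> B \<Longrightarrow> x v \<in> X v" "sym_ivec \<theta>"
    and "\<And>v. v \<in> B \<Longrightarrow> x' v = x v" "strict_min \<theta> B x"
  shows "hat_energy V E X A x' \<theta> (fix_labels B x \<mu>) \<le> hat_energy V E X A x' \<theta> \<mu>"
proof (rule ccontr)
  assume less: "\<not> ?thesis"
  then have "\<mu> (NodeIx v (x v)) = 1" if "v \<in> B" for v
    using strict_min_integral[of \<mu> A B x \<theta> x' v] assms that by auto
  then have "fix_labels B x \<mu> = \<mu>"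
    using assms by (intro fix_labels_id) auto
  with less show False by simp
qed

section \<open>Improving mappings and reparametrization\<close>

lemma improving_objective_eq:
  "improving_objective V E X \<theta> p \<mu> = energy E X V \<theta> \<mu> - energy E X V \<theta> (lin_ext X p \<mu>)"
  by (simp only: improving_objective_def energy_diff_left energy_lin_ext_transpose)

text \<open>The indicator vector of \<open>y\<close> is a fixed point of the mapping, so the
  objective takes the value zero. A zero minimum thus amounts to nonnegativity, and the minimizers
  are then the zeros.\<close>

lemma strictly_improving_iff:
  assumes y: "\<And>v. v \<in> V \<Longrightarrow> y v \<in> X v" and B: "B \<subseteq> V"
  shows "strictly_improving V E X \<theta> (all_to_one B y) \<longleftrightarrow>
    (\<forall>\<mu>\<in>polytope V. energy E X V \<theta> (fix_labels B y \<mu>) \<le> energy E X V \<theta> \<mu> \<and>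
       (energy E X V \<theta> \<mu> = energy E X V \<theta> (fix_labels B y \<mu>) \<longrightarrow> fix_labels B y \<mu> = \<mu>))"
    (is "_ \<longleftrightarrow> ?R")
proof
  assume "strictly_improving V E X \<theta> (all_to_one B y)"
  then show ?R
    unfolding strictly_improving_def improving_def is_arg_min_def improving_objective_eq
    by (smt (verit, ccfv_threshold))
next
  assume R: ?R
  let ?\<delta> = "delta E V y"
  have \<delta>: "?\<delta> \<in> polytope V"
    using y by (intro delta_in_polytope) auto
  have "fix_labels B y ?\<delta> = ?\<delta>"
    using y B by (intro fix_labels_id[OF \<delta>]) auto
  then have zero: "improving_objective V E X \<theta> (all_to_one B y) ?\<delta> = 0"
    by (simp add: improving_objective_eq)
  have nonneg: "0 \<le> improving_objective V E X \<theta> (all_to_one B y) \<mu>" if "\<mu> \<in> polytope V" for \<mu>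
    using R that by (simp add: improving_objective_eq)
  have "idempotent_map V X (all_to_one B y)"
    using y by (auto simp: idempotent_map_def all_to_one_def)
  moreover have "is_arg_min (improving_objective V E X \<theta> (all_to_one B y)) (\<lambda>\<mu>. \<mu> \<in> polytope V) ?\<delta>"
    using \<delta> zero nonneg by (force simp: is_arg_min_def)
  moreover have "fix_labels B y \<mu> = \<mu>"
    if "is_arg_min (improving_objective V E X \<theta> (all_to_one B y)) (\<lambda>\<mu>. \<mu> \<in> polytope V) \<mu>" for \<mu>
  proof -
    have "\<mu> \<in> polytope V" "improving_objective V E X \<theta> (all_to_one B y) \<mu> = 0"
      using that \<delta> zero nonneg[of \<mu>] by (auto simp: is_arg_min_def not_less intro: antisym)
    then show ?thesis
      using R by (simp add: improving_objective_eq)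
  qed
  ultimately show "strictly_improving V E X \<theta> (all_to_one B y)"
    using zero unfolding strictly_improving_def improving_def by blast
qed

text \<open>Marginalization turns the messages added on an edge into node terms that cancel those
  subtracted at its ends.\<close>

lemma energy_reparam:
  assumes \<mu>: "\<mu> \<in> polytope V"
  shows "energy E X V (reparam E \<phi> \<theta>) \<mu> = energy E X V \<theta> \<mu>"
proof -
  let ?m = "\<lambda>u v. \<Sum>i\<in>X u. \<phi> u v i * \<mu> (NodeIx u i)"
  let ?I = "inner_edges E V"
  have pair: "pair_energy X (reparam E \<phi> \<theta>) \<mu> u v = pair_energy X \<theta> \<mu> u v + (?m u v + ?m v u)"
    if "(u, v) \<in> ?I" for u v
  proof -
    have uv: "u \<in> V" "v \<in> V" "{u, v} \<in> E" using that by (auto simp: inner_edges_def)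
    have "(\<Sum>i\<in>X u. \<Sum>j\<in>X v. \<phi> u v i * \<mu> (EdgeIx u v i j)) = ?m u v"
      using uv by (simp add: polytopeD(5)[OF \<mu>] flip: sum_distrib_left)
    moreover have "(\<Sum>i\<in>X u. \<Sum>j\<in>X v. \<phi> v u j * \<mu> (EdgeIx u v i j)) = ?m v u"
      using uv by (subst sum.swap) (simp add: polytopeD(6)[OF \<mu>] flip: sum_distrib_left)
    ultimately show ?thesis
      by (simp add: pair_energy_def distrib_right sum.distrib)
  qed
  have I: "?I = (SIGMA u:V. {v. {v, u} \<in> E})"
    by (auto simp: inner_edges_def insert_commute dest: edgeD)
  have fin: "finite {v. {v, u} \<in> E}" for u
    by (rule finite_subset[OF _ finite_V]) (auto dest: edgeD)
  \<comment> \<open>Over ordered pairs the messages of first and of second ends have the same total,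
    so halving leaves exactly the node terms.\<close>
  have "(\<Sum>(u, v)\<in>?I. ?m v u) = (\<Sum>(u, v)\<in>?I. ?m u v)"
    by (rule sum.reindex_bij_witness[of _ prod.swap prod.swap])
       (auto simp: inner_edges_def insert_commute)
  moreover have "(\<Sum>(u, v)\<in>?I. ?m u v) = (\<Sum>u\<in>V. \<Sum>i\<in>X u. (\<Sum>v | {v, u} \<in> E. \<phi> u v i) * \<mu> (NodeIx u i))"
    unfolding I sum_distrib_right
    by (subst sum.Sigma[symmetric]) (auto simp: finite_V fin intro!: sum.cong sum.swap)
  moreover have "(\<Sum>(u, v)\<in>?I. pair_energy X (reparam E \<phi> \<theta>) \<mu> u v) =
      (\<Sum>(u, v)\<in>?I. pair_energy X \<theta> \<mu> u v) + ((\<Sum>(u, v)\<in>?I. ?m u v) + (\<Sum>(u, v)\<in>?I. ?m v u))"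
    unfolding sum.distrib[symmetric] by (rule sum.cong) (auto simp: pair)
  ultimately show ?thesis
    by (simp add: energy_alt left_diff_distrib sum_subtractf field_simps)
qed

lemma strictly_improving_reparam:
  assumes "\<And>v. v \<in> V \<Longrightarrow> y v \<in> X v" and "B \<subseteq> V"
  shows "strictly_improving V E X (reparam E \<phi> \<theta>) (all_to_one B y) \<longleftrightarrow>
    strictly_improving V E X \<theta> (all_to_one B y)"
proof -
  have "fix_labels B y \<mu> \<in> polytope V" if "\<mu> \<in> polytope V" for \<mu>
    using that assms by (intro fix_labels_in_polytope) auto
  then show ?thesis
    by (simp add: strictly_improving_iff[OF assms] energy_reparam)
qed

text \<open>The nested comparison with \<open>A = V\<close>, where the larger problem has no
  boundary terms.\<close>

lemma strict_min_imp_strictly_improving: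
  assumes y: "\<And>v. v \<in> V \<Longrightarrow> y v \<in> X v" and B: "B \<subseteq> V" and \<theta>: "sym_ivec \<theta>" and min: "strict_min \<theta> B y"
  shows "strictly_improving V E X \<theta> (all_to_one B y)"
proof (intro strictly_improving_iff[THEN iffD2] ballI conjI impI y B)
  have yB: "y v \<in> X v" if "v \<in> B" for v using y B that by auto
  fix \<mu> assume \<mu>: "\<mu> \<in> polytope V"
  show "energy E X V \<theta> (fix_labels B y \<mu>) \<le> energy E X V \<theta> \<mu>"
    using strict_min_fix_labels_le[OF \<mu> B subset_refl yB \<theta> refl min] by simp
  assume "energy E X V \<theta> \<mu> = energy E X V \<theta> (fix_labels B y \<mu>)"
  then show "fix_labels B y \<mu> = \<mu>"
    using strict_min_integral[OF \<mu> B subset_refl yB \<theta> refl min]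
    by (intro fix_labels_id[OF \<mu> subset_refl yB]) auto
qed

section \<open>Extending vectors near the proposal from \<open>B\<close> to all nodes\<close>

lemma card_labels_pos: "v \<in> V \<Longrightarrow> card (X v) > 0"
  using labels by (simp add: card_gt_0_iff)

text \<open>
  A vector on \<open>B\<close> is extended to \<open>V\<close> with uniform marginals outside \<open>B\<close>.  On a boundary edge the mass
  of a label \<open>i \<noteq> y u\<close> is moved to the single partner label \<open>s u v i\<close>, and the row of \<open>y u\<close>
  absorbs the rest, which is nonnegative as long as \<open>\<mu>\<close> is close to \<open>y\<close>.
\<close>

definition coupling ::
  "('v \<Rightarrow> 'v \<Rightarrow> 'l \<Rightarrow> 'l) \<Rightarrow> ('v \<Rightarrow> 'l) \<Rightarrow> ('v, 'l) ivec \<Rightarrow> 'v \<Rightarrow> 'v \<Rightarrow> 'l \<Rightarrow> 'l \<Rightarrow> real" where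
  "coupling s y \<mu> u v i j =
     (if i = y u
      then 1 / card (X v) - (\<Sum>i'\<in>X u - {y u}. of_bool (j = s u v i') * \<mu> (NodeIx u i'))
      else of_bool (j = s u v i) * \<mu> (NodeIx u i))"

fun extension ::
  "('v \<Rightarrow> 'v \<Rightarrow> 'l \<Rightarrow> 'l) \<Rightarrow> 'v set \<Rightarrow> ('v \<Rightarrow> 'l) \<Rightarrow> ('v, 'l) ivec \<Rightarrow> ('v, 'l) ivec" where
  "extension s B y \<mu> (NodeIx v i) =
     (if v \<in> V \<and> i \<in> X v then if v \<in> B then \<mu> (NodeIx v i) else 1 / card (X v) else 0)"
| "extension s B y \<mu> (EdgeIx u v i j) =
     (if {u, v} \<in> E \<and> i \<in> X u \<and> j \<in> X v
      then if u \<in> B then if v \<in> B then \<mu> (EdgeIx u v i j) else coupling s y \<mu> u v i j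
           else if v \<in> B then coupling s y \<mu> v u j i else 1 / (card (X u) * card (X v))
      else 0)"

context
  fixes s :: "'v \<Rightarrow> 'v \<Rightarrow> 'l \<Rightarrow> 'l" and B :: "'v set" and y :: "'v \<Rightarrow> 'l" and \<mu> :: "('v, 'l) ivec"
  assumes B: "B \<subseteq> V" and y: "\<And>v. v \<in> V \<Longrightarrow> y v \<in> X v" and \<mu>: "\<mu> \<in> polytope B"
    and s: "\<And>u v i. \<lbrakk>{u, v} \<in> E; i \<in> X u\<rbrakk> \<Longrightarrow> s u v i \<in> X v"
    and close: "\<And>u v. u \<in> B \<Longrightarrow> v \<in> V \<Longrightarrow> 1 - \<mu> (NodeIx u (y u)) \<le> 1 / card (X v)"
begin

lemma sum_other_labels:
  assumes "u \<in> B"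
  shows "(\<Sum>i\<in>X u - {y u}. \<mu> (NodeIx u i)) = 1 - \<mu> (NodeIx u (y u))"
  using assms B y[of u] finite_labels[of u] by (auto simp: sum_diff1 polytopeD(4)[OF \<mu>])

text \<open>An entry of row \<open>y u\<close> loses at most the whole mass off \<open>y u\<close>,
  which \<open>close\<close> bounds by the uniform entry.\<close>

lemma coupling_nonneg:
  assumes "u \<in> B" "v \<in> V"
  shows "0 \<le> coupling s y \<mu> u v i j"
proof -
  have "(\<Sum>i'\<in>X u - {y u}. of_bool (j = s u v i') * \<mu> (NodeIx u i')) \<le> (\<Sum>i'\<in>X u - {y u}. \<mu> (NodeIx u i'))"
    by (rule sum_mono) (auto simp: polytopeD(3)[OF \<mu>])
  also have "\<dots> \<le> 1 / card (X v)"
    using close[OF assms] by (simp add: sum_other_labels assms)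
  finally show ?thesis
    by (simp add: coupling_def polytopeD(3)[OF \<mu>])
qed

text \<open>A row \<open>i \<noteq> y u\<close> puts its mass on one partner label. Row
  \<open>y u\<close> starts from total mass one and loses the mass of all other rows, which leaves
  its own marginal.\<close>

lemma coupling_row:
  assumes uv: "u \<in> B" "{u, v} \<in> E" "i \<in> X u"
  shows "(\<Sum>j\<in>X v. coupling s y \<mu> u v i j) = \<mu> (NodeIx u i)"
proof -
  have fin: "finite (X v)" and pos: "card (X v) > 0"
    using edgeD[OF uv(2)] finite_labels card_labels_pos by auto
  have point: "(\<Sum>j\<in>X v. of_bool (j = s u v i') * c) = c" if "i' \<in> X u" for i' and c :: real
    using fin s[OF uv(2) that] by (simp add: of_bool_def flip: sum_distrib_right)
  have "(\<Sum>j\<in>X v. \<Sum>i'\<in>X u - {y u}. of_bool (j = s u v i') * \<mu> (NodeIx u i')) =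
      (\<Sum>i'\<in>X u - {y u}. \<mu> (NodeIx u i'))"
    by (subst sum.swap) (simp add: point)
  then show ?thesis
    using pos uv
    by (cases "i = y u") (simp_all add: coupling_def sum_subtractf sum_other_labels point)
qed

text \<open>Row \<open>y u\<close> is by construction what the other rows leave of the uniform
  marginal.\<close>

lemma coupling_column:
  assumes uv: "u \<in> B" "{u, v} \<in> E"
  shows "(\<Sum>i\<in>X u. coupling s y \<mu> u v i j) = 1 / card (X v)"
proof -
  have "finite (X u)" "y u \<in> X u"
    using edgeD[OF uv(2)] finite_labels y by auto
  then show ?thesis
    by (simp add: sum.remove[of "X u" "y u"] coupling_def)
qed

lemma extension_in_polytope: "extension s B y \<mu> \<in> polytope V"
proof (rule polytopeI)
  show "extension s B y \<mu> k = 0" if "k \<notin> index_set E X V" for k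
    using that by (cases k) (auto dest: edgeD)
  show "sym_ivec (extension s B y \<mu>)"
    using sym_ivecD[OF polytopeD(2)[OF \<mu>]] by (auto simp: sym_ivec_def insert_commute mult.commute)
  show "0 \<le> extension s B y \<mu> k" for k
    by (cases k) (auto simp: polytopeD(3)[OF \<mu>] insert_commute dest: edgeD intro!: coupling_nonneg)
  show "(\<Sum>i\<in>X v. extension s B y \<mu> (NodeIx v i)) = 1" if "v \<in> V" for v
    using that card_labels_pos[of v] by (cases "v \<in> B") (auto simp: polytopeD(4)[OF \<mu>])
  show "(\<Sum>j\<in>X v. extension s B y \<mu> (EdgeIx u v i j)) = extension s B y \<mu> (NodeIx u i)"
    if uv: "u \<in> V" "v \<in> V" "{u, v} \<in> E" "i \<in> X u" for u v i
    using uv card_labels_pos[of v]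
    by (cases "u \<in> B"; cases "v \<in> B")
       (simp_all add: polytopeD(5)[OF \<mu>] coupling_row coupling_column insert_commute)
qed

text \<open>Equality in \<open>edge_bound\<close>: the row of \<open>y u\<close> is constant, hence
  equal to its maximum, and the mass of every other row sits at a minimum of that row.\<close>

lemma pair_energy_extension:
  assumes uv: "u \<in> B" "v \<notin> B" "{u, v} \<in> E"
    and const: "\<And>j. j \<in> X v \<Longrightarrow> \<theta> (EdgeIx u v (y u) j) = c"
    and s_min: "\<And>i. i \<in> X u \<Longrightarrow>
      \<theta> (EdgeIx u v i (s u v i)) = Min ((\<lambda>j. \<theta> (EdgeIx u v i j)) ` X v)"
  shows "pair_energy X \<theta> (extension s B y \<mu>) u v -
      (\<Sum>j\<in>X v. \<theta> (EdgeIx u v (y u) j) * extension s B y \<mu> (NodeIx v j)) =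
    (\<Sum>i\<in>X u. hat_pot X \<theta> u v (y u) i * \<mu> (NodeIx u i)) - hat_pot X \<theta> u v (y u) (y u)"
proof -
  have V: "u \<in> V" "v \<in> V" and fin: "finite (X v)" and ne: "X v \<noteq> {}" and pos: "card (X v) > 0"
    using edgeD[OF uv(3)] labels card_labels_pos by auto
  have "(\<lambda>j. \<theta> (EdgeIx u v (y u) j)) ` X v = {c}"
    using const ne by auto
  then have hat: "hat_pot X \<theta> u v (y u) (y u) = c"
    by (simp add: hat_pot_def)
  have row: "(\<Sum>j\<in>X v. \<theta> (EdgeIx u v i j) * coupling s y \<mu> u v i j) = hat_pot X \<theta> u v (y u) i * \<mu> (NodeIx u i)"
    if i: "i \<in> X u" for i
  proof (cases "i = y u")
    case True
    have "(\<Sum>j\<in>X v. \<theta> (EdgeIx u v i j) * coupling s y \<mu> u v i j) = c * (\<Sum>j\<in>X v. coupling s y \<mu> u v i j)"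
      by (simp add: True const sum_distrib_left)
    then show ?thesis
      using coupling_row[OF uv(1,3) i] hat True by simp
  next
    case False
    have "(\<Sum>j\<in>X v. \<theta> (EdgeIx u v i j) * coupling s y \<mu> u v i j) =
        (\<Sum>j\<in>X v. if j = s u v i then \<theta> (EdgeIx u v i (s u v i)) * \<mu> (NodeIx u i) else 0)"
      using False by (intro sum.cong) (auto simp: coupling_def)
    then show ?thesis
      using False fin s[OF uv(3) i] s_min[OF i] by (simp add: hat_pot_def)
  qed
  have "pair_energy X \<theta> (extension s B y \<mu>) u v =
      (\<Sum>i\<in>X u. hat_pot X \<theta> u v (y u) i * \<mu> (NodeIx u i))"
    unfolding pair_energy_def using uv by (intro sum.cong) (simp_all add: row)
  moreover have "(\<Sum>j\<in>X v. \<theta> (EdgeIx u v (y u) j) * extension s B y \<mu> (NodeIx v j)) = c"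
    using V uv pos by (simp add: const)
  ultimately show ?thesis
    by (simp add: hat)
qed

end

section \<open>Strict improvement implies strict minimality\<close>

text \<open>A small step from the indicator vector towards a competitor on \<open>B\<close> extends
  to \<open>V\<close> with boundary terms attaining the bound. Strict improvement at the extension
  forces the step to be trivial.\<close>

lemma strictly_improving_imp_strict_min:
  assumes y: "\<And>v. v \<in> V \<Longrightarrow> y v \<in> X v" and B: "B \<subseteq> V" and \<theta>: "sym_ivec \<theta>"
    and const: "\<And>u v j. {u, v} \<in> E \<Longrightarrow> j \<in> X v \<Longrightarrow> \<theta> (EdgeIx u v (y u) j) = \<theta> (EdgeIx u v (y u) (y v))"
    and imp: "strictly_improving V E X \<theta> (all_to_one B y)"
  shows "strict_min \<theta> B y"
  unfolding strict_min_def
proof (intro ballI impI)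
  fix \<mu> assume \<mu>: "\<mu> \<in> polytope B"
    and le: "hat_energy V E X B y \<theta> \<mu> \<le> hat_energy V E X B y \<theta> (delta E B y)"
  have yB: "y v \<in> X v" if "v \<in> B" for v
    using that y B by auto
  \<comment> \<open>A step length below \<open>1 / card (X v)\<close> for all nodes at once; the
    summand one keeps it positive even for empty \<open>V\<close>.\<close>
  define \<epsilon> :: real where "\<epsilon> = 1 / (1 + (\<Sum>v\<in>V. card (X v)))"
  have \<epsilon>: "0 < \<epsilon>" "\<epsilon> \<le> 1"
    using of_nat_0_le_iff[of "\<Sum>v\<in>V. card (X v)", where ?'a = real]
    unfolding \<epsilon>_def by (auto simp del: of_nat_0_le_iff of_nat_sum)
  have \<epsilon>_card: "\<epsilon> \<le> 1 / card (X v)" if "v \<in> V" for v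
  proof -
    have "card (X v) \<le> (\<Sum>v\<in>V. card (X v))"
      using that finite_V by (intro member_le_sum) auto
    then show ?thesis
      using card_labels_pos[OF that] unfolding \<epsilon>_def
      by (intro divide_left_mono mult_pos_pos) (simp_all del: of_nat_sum)
  qed
  define m where "m = (\<lambda>k. (1 - \<epsilon>) * delta E B y k + \<epsilon> * \<mu> k)"
  have m: "m \<in> polytope B"
    unfolding m_def using \<epsilon> \<mu> yB B by (intro polytope_mix delta_in_polytope) auto
  have m_node: "m (NodeIx u (y u)) = 1 - \<epsilon> * (1 - \<mu> (NodeIx u (y u)))" if "u \<in> B" for u
    using that by (simp add: m_def algebra_simps)
  have close: "1 - m (NodeIx u (y u)) \<le> 1 / card (X v)" if "u \<in> B" "v \<in> V" for u v
  proof -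
    have "\<epsilon> * (1 - \<mu> (NodeIx u (y u))) \<le> \<epsilon>"
      using \<epsilon> polytopeD(3)[OF \<mu>] by (simp add: mult_left_le)
    then show ?thesis
      using \<epsilon>_card[OF that(2)] m_node[OF that(1)] by simp
  qed
  have "\<exists>j\<in>X v. \<theta> (EdgeIx u v i j) = Min ((\<lambda>j. \<theta> (EdgeIx u v i j)) ` X v)" if "{u, v} \<in> E" for u v i
  proof -
    have "Min ((\<lambda>j. \<theta> (EdgeIx u v i j)) ` X v) \<in> (\<lambda>j. \<theta> (EdgeIx u v i j)) ` X v"
      using labels[of v] edgeD[OF that] by (intro Min_in) auto
    then show ?thesis by auto
  qed
  then obtain s where s: "{u, v} \<in> E \<Longrightarrow> s u v i \<in> X v"
      "{u, v} \<in> E \<Longrightarrow> \<theta> (EdgeIx u v i (s u v i)) = Min ((\<lambda>j. \<theta> (EdgeIx u v i j)) ` X v)" for u v i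
    by metis
  let ?\<nu> = "extension s B y m"
  let ?h = "\<lambda>\<mu> u v. \<Sum>i\<in>X u. hat_pot X \<theta> u v (y u) i * \<mu> (NodeIx u i)"
  have \<nu>: "?\<nu> \<in> polytope V"
    by (intro extension_in_polytope B y m s(1) close)
  have \<nu>_B: "energy E X B \<theta> ?\<nu> = energy E X B \<theta> m"
  proof (rule energy_cong)
    fix k assume "k \<in> index_set E X B"
    then show "?\<nu> k = m k"
      using B by (cases k) auto
  qed
  have bd: "(\<Sum>(u, v)\<in>boundary_edges V E B.
        pair_energy X \<theta> ?\<nu> u v - (\<Sum>j\<in>X v. \<theta> (EdgeIx u v (y u) j) * ?\<nu> (NodeIx v j))) =
      (\<Sum>(u, v)\<in>boundary_edges V E B. ?h m u v - ?h (delta E B y) u v)"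
  proof (rule sum.cong[OF refl], clarify)
    fix u v assume "(u, v) \<in> boundary_edges V E B"
    then have uv: "u \<in> B" "v \<notin> B" "{u, v} \<in> E"
      by (auto simp: boundary_edges_def)
    have "?h (delta E B y) u v = hat_pot X \<theta> u v (y u) (y u)"
      using uv yB[OF uv(1)] finite_labels[of u] B
      by (auto simp: of_bool_def if_distrib[of "(*) _"] cong: if_cong)
    then show "pair_energy X \<theta> ?\<nu> u v - (\<Sum>j\<in>X v. \<theta> (EdgeIx u v (y u) j) * ?\<nu> (NodeIx v j)) =
        ?h m u v - ?h (delta E B y) u v"
      using pair_energy_extension[where \<theta> = \<theta>, OF B y m s(1) close uv] const[OF uv(3)] s(2)[OF uv(3)] by simp
  qed
  have "energy E X V \<theta> ?\<nu> - energy E X V \<theta> (fix_labels B y ?\<nu>) =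
      energy E X B \<theta> m - energy E X B \<theta> (delta E B y) +
      (\<Sum>(u, v)\<in>boundary_edges V E B. ?h m u v - ?h (delta E B y) u v)"
    by (subst energy_fix_labels_diff[OF \<nu> B subset_refl yB \<theta>]) (simp_all only: bd \<nu>_B)
  also have "\<dots> = hat_energy V E X B y \<theta> m - hat_energy V E X B y \<theta> (delta E B y)"
    by (simp add: hat_energy_def sum_subtractf case_prod_unfold)
  also have "\<dots> = \<epsilon> * (hat_energy V E X B y \<theta> \<mu> - hat_energy V E X B y \<theta> (delta E B y))"
    unfolding m_def hat_energy_mix by (simp add: algebra_simps)
  also have "\<dots> \<le> 0"
    using \<epsilon> le by (simp add: mult_le_0_iff)
  finally have "energy E X V \<theta> ?\<nu> \<le> energy E X V \<theta> (fix_labels B y ?\<nu>)"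
    by simp
  moreover have "energy E X V \<theta> (fix_labels B y ?\<nu>) \<le> energy E X V \<theta> ?\<nu> \<and>
      (energy E X V \<theta> ?\<nu> = energy E X V \<theta> (fix_labels B y ?\<nu>) \<longrightarrow> fix_labels B y ?\<nu> = ?\<nu>)"
    by (rule bspec[OF strictly_improving_iff[THEN iffD1, OF y B imp] \<nu>])
  \<comment> \<open>The two inequalities give equality, and the strictness clause applies.\<close>
  ultimately have "fix_labels B y ?\<nu> = ?\<nu>"
    by linarith
  show "\<mu> = delta E B y"
  proof (rule eq_deltaI[OF \<mu> B])
    fix v assume v: "v \<in> B"
    then have "fix_labels B y ?\<nu> (NodeIx v (y v)) = 1"
      using B yB by (subst fix_labels_node[OF \<nu>]) auto
    then have "m (NodeIx v (y v)) = 1"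
      using \<open>fix_labels B y ?\<nu> = ?\<nu>\<close> v yB B by auto
    then show "\<mu> (NodeIx v (y v)) = 1"
      using m_node[OF v] \<epsilon> by simp
  qed
qed

end

section \<open>Termination and invariants of the algorithm\<close>

lemma prune_step_shrinks:
  assumes "prune_step V E X \<theta> A x A' x'"
  shows "A' \<subseteq> A" "x' \<in> PiE A' X"
  using assms by (auto simp: prune_step_def integral_nodes_def labeling_of_def)

text \<open>The body is entered again only after a pass that changed the set, so each further
  iteration costs at least one node.\<close>

lemma prune_state_bounds:
  assumes "prune_state V E X \<theta> A0 x0 t A x" and "finite A0"
  shows "A \<subseteq> A0 \<and> t + card A \<le> card A0"
  using assms
proof (induction rule: prune_state.induct)
  case (repeat t A x A' x')
  then have "A' \<subset> A" and "finite A"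
    using prune_step_shrinks[OF repeat.hyps(2)] finite_subset by blast+
  then have "card A' < card A"
    by (rule psubset_card_mono[rotated])
  with \<open>A' \<subset> A\<close> repeat show ?case by auto
qed simp

context graphical_model
begin

text \<open>The solution on \<open>A\<close> costs no more than its version fixed on
  \<open>B\<close>, so strict minimality makes it integral at \<open>y\<close> on \<open>B\<close>.
  As \<open>x\<close> equals \<open>y\<close> there, the boundary test removes no node of
  \<open>B\<close>.\<close>

lemma prune_step_keeps:
  assumes step: "prune_step V E X \<theta> A x A' x'" and BA: "B \<subseteq> A" and A: "A \<subseteq> V" and \<theta>: "sym_ivec \<theta>"
    and y: "\<And>v. v \<in> B \<Longrightarrow> y v \<in> X v" and min: "strict_min \<theta> B y" and x: "\<And>v. v \<in> B \<Longrightarrow> x v = y v"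
  shows "B \<subseteq> A' \<and> (\<forall>v\<in>B. x' v = y v)"
proof -
  obtain \<mu> where opt: "subproblem_solution V E X \<theta> A x \<mu>"
    and A': "A' = integral_nodes X A \<mu> - {u \<in> boundary_nodes V E A. \<mu> (NodeIx u (x u)) \<noteq> 1}"
    and x': "labeling_of X A' \<mu> x'"
    using step by (auto simp: prune_step_def)
  have \<mu>: "\<mu> \<in> polytope A"
    using opt by (simp add: subproblem_solution_def is_arg_min_def)
  have "fix_labels B y \<mu> \<in> polytope A"
    by (intro fix_labels_in_polytope \<mu> A y)
  then have "hat_energy V E X A x \<theta> \<mu> \<le> hat_energy V E X A x \<theta> (fix_labels B y \<mu>)"
    using opt by (auto simp: subproblem_solution_def is_arg_min_def not_less)
  then have one: "\<mu> (NodeIx v (y v)) = 1" if "v \<in> B" for v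
    using strict_min_integral[OF \<mu> BA A y \<theta> x min] that by auto
  have node: "\<mu> (NodeIx v i) = of_bool (i = y v)" if "v \<in> B" for v i
    using node_of_integral[OF \<mu> A _ one[OF that]] BA that by auto
  have "B \<subseteq> A'"
    using BA by (auto simp: A' integral_nodes_def node x)
  moreover have "x' v = y v" if "v \<in> B" for v
    using x' that node[OF that, of "x' v"] \<open>B \<subseteq> A'\<close> by (auto simp: labeling_of_def)
  ultimately show ?thesis by blast
qed

lemma prune_state_keeps:
  assumes "prune_state V E X \<theta> A0 x0 t A x" and B: "B \<subseteq> A0" and A0: "A0 \<subseteq> V" and \<theta>: "sym_ivec \<theta>"
    and y: "\<And>v. v \<in> B \<Longrightarrow> y v \<in> X v" and min: "strict_min \<theta> B y" and x0: "\<And>v. v \<in> B \<Longrightarrow> x0 v = y v"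
  shows "B \<subseteq> A \<and> (\<forall>v\<in>B. x v = y v)"
  using assms(1)
proof (induction rule: prune_state.induct)
  case start
  with B x0 show ?case by simp
next
  case (repeat t A x A' x')
  have "A \<subseteq> V"
    using prune_state_bounds[OF repeat.hyps(1)] A0 finite_V finite_subset by blast
  with repeat show ?case
    by (intro prune_step_keeps[OF repeat.hyps(2) _ _ \<theta> y min]) auto
qed

text \<open>A block of entries zero and one with sum one has an entry one, so a subproblem solution
  labels all remaining nodes.\<close>

lemma prune_step_exists:
  assumes opt: "subproblem_solution V E X \<theta> A x \<mu>"
  shows "\<exists>A' x'. prune_step V E X \<theta> A x A' x'"
proof -
  define A' where "A' = integral_nodes X A \<mu> - {u \<in> boundary_nodes V E A. \<mu> (NodeIx u (x u)) \<noteq> 1}"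
  have \<mu>: "\<mu> \<in> polytope A"
    using opt by (simp add: subproblem_solution_def is_arg_min_def)
  have "\<exists>i\<in>X u. \<mu> (NodeIx u i) = 1" if "u \<in> A'" for u
  proof (rule ccontr)
    assume "\<not> ?thesis"
    with that have "(\<Sum>i\<in>X u. \<mu> (NodeIx u i)) = 0"
      by (intro sum.neutral) (auto simp: A'_def integral_nodes_def)
    with that show False
      using polytopeD(4)[OF \<mu>, of u] by (auto simp: A'_def integral_nodes_def)
  qed
  then obtain x' where "\<forall>u\<in>A'. x' u \<in> X u \<and> \<mu> (NodeIx u (x' u)) = 1"
    by metis
  \<comment> \<open>\<open>PiE\<close> also prescribes the values off \<open>A'\<close>, hence the
    restriction.\<close>
  then have "labeling_of X A' \<mu> (restrict x' A')"
    by (auto simp: labeling_of_def)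
  with opt show ?thesis
    unfolding prune_step_def A'_def by blast
qed

text \<open>If the set is unchanged, no boundary node failed the test. So \<open>x'\<close> agrees
  with \<open>x\<close> on the boundary and defines the same subproblem, whose unique solution is
  the indicator vector of \<open>x'\<close>.\<close>

lemma prune_fixpoint_strict_min:
  assumes step: "prune_step V E X \<theta> A x A x'" and A: "A \<subseteq> V"
    and unique: "\<exists>!\<mu>. subproblem_solution V E X \<theta> A x \<mu>"
  shows "strict_min \<theta> A x'"
proof -
  obtain \<mu> where opt: "subproblem_solution V E X \<theta> A x \<mu>"
    and A': "A = integral_nodes X A \<mu> - {u \<in> boundary_nodes V E A. \<mu> (NodeIx u (x u)) \<noteq> 1}"
    and x': "labeling_of X A \<mu> x'"
    using step by (auto simp: prune_step_def)
  have \<mu>: "\<mu> \<in> polytope A"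
    using opt by (simp add: subproblem_solution_def is_arg_min_def)
  have one: "\<mu> (NodeIx v (x' v)) = 1" if "v \<in> A" for v
    using x' that by (simp add: labeling_of_def)
  have \<mu>_eq: "\<mu> = delta E A x'"
    by (rule eq_deltaI[OF \<mu> A one])
  have "x' u = x u" if "u \<in> boundary_nodes V E A" for u
  proof -
    have u: "u \<in> A"
      using that by (simp add: boundary_nodes_def)
    then have "\<mu> (NodeIx u (x u)) = 1"
      using A' that by blast
    then show ?thesis
      using node_of_integral[OF \<mu> A u one[OF u], of "x u"] by (simp split: if_splits add: of_bool_def)
  qed
  then have hat: "hat_energy V E X A x' \<theta> \<nu> = hat_energy V E X A x \<theta> \<nu>" for \<nu>
    by (intro hat_energy_cong) auto
  show ?thesis
    unfolding strict_min_def hat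
  proof (intro ballI impI)
    fix \<nu> assume "\<nu> \<in> polytope A"
      and "hat_energy V E X A x \<theta> \<nu> \<le> hat_energy V E X A x \<theta> (delta E A x')"
    then have "subproblem_solution V E X \<theta> A x \<nu>"
      using opt unfolding subproblem_solution_def is_arg_min_def \<mu>_eq by fastforce
    then show "\<nu> = delta E A x'"
      using unique opt \<mu>_eq by blast
  qed
qed

lemma strict_min_cong:
  assumes "\<And>v. v \<in> A \<Longrightarrow> x v = y v"
  shows "strict_min \<theta> A x \<longleftrightarrow> strict_min \<theta> A y"
proof -
  have "delta E A x = delta E A y"
  proof
    fix k show "delta E A x k = delta E A y k"
      using assms by (cases k) auto
  qed
  moreover have "hat_energy V E X A x \<theta> \<mu> = hat_energy V E X A y \<theta> \<mu>" for \<mu>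
    using assms by (intro hat_energy_cong) (auto simp: boundary_nodes_def)
  ultimately show ?thesis
    by (simp add: strict_min_def)
qed

text \<open>Induction on the size of the current set: a pass either leaves it unchanged and ends the
  run, or makes it smaller.\<close>

lemma prune_output_exists:
  assumes "prune_state V E X \<theta> A0 x0 t A x" and A0: "finite A0"
    and solvable: "\<And>t A x. prune_state V E X \<theta> A0 x0 t A x \<Longrightarrow> \<exists>\<mu>. subproblem_solution V E X \<theta> A x \<mu>"
  shows "\<exists>A' x'. prune_output V E X \<theta> A0 x0 A' x'"
  using assms(1)
proof (induction "card A" arbitrary: t A x rule: less_induct)
  case less
  obtain A' x' where step: "prune_step V E X \<theta> A x A' x'"
    using solvable[OF less.prems] prune_step_exists by blast
  show ?case
  proof (cases "A' = A")
    case True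
    with less.prems step show ?thesis
      unfolding prune_output_def by blast
  next
    case False
    have "finite A"
      using prune_state_bounds[OF less.prems A0] A0 finite_subset by blast
    then have "card A' < card A"
      using False prune_step_shrinks(1)[OF step] by (intro psubset_card_mono) auto
    then show ?thesis
      using less.hyps prune_state.repeat[OF less.prems step False] by blast
  qed
qed

end

section \<open>Correctness and maximality of the output set\<close>

theorem theorem4:
  fixes V :: "'v set" and E :: "'v set set" and X :: "'v \<Rightarrow> 'l set"
    and \<theta> \<theta>\<psi> \<mu>0 :: "('v, 'l) ivec" and A0 :: "'v set" and x0 y :: "'v \<Rightarrow> 'l"
  assumes graph: "simple_graph V E"
    and labels: "\<And>v. v \<in> V \<Longrightarrow> finite (X v) \<and> X v \<noteq> {}"
    and potentials: "\<theta> \<in> ivec_space E X V"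
    and init_min: "is_arg_min (energy E X V \<theta>) (\<lambda>\<mu>. \<mu> \<in> local_polytope E X V) \<mu>0"
    and init_set: "A0 = integral_nodes X V \<mu>0"
    and proposal: "labeling_of X A0 \<mu>0 x0"
    and extension: "y \<in> PiE V X" "\<And>u. u \<in> A0 \<Longrightarrow> y u = x0 u"
    and reparametrized: "\<theta>\<psi> = reparam E (psi \<theta> y) \<theta>"
    and unique: "\<And>t A x. prune_state V E X \<theta>\<psi> A0 x0 t A x \<Longrightarrow>
                   \<exists>!\<mu>. subproblem_solution V E X \<theta>\<psi> A x \<mu>"
  shows "(\<exists>T. \<forall>t A x. prune_state V E X \<theta>\<psi> A0 x0 t A x \<longrightarrow> t \<le> T) \<and>
         (\<exists>A' x'. prune_output V E X \<theta>\<psi> A0 x0 A' x') \<and>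
         (\<forall>A' x'. prune_output V E X \<theta>\<psi> A0 x0 A' x' \<longrightarrow>
            A' \<subseteq> V \<and>
            strictly_improving V E X \<theta> (all_to_one A' y) \<and>
            (\<forall>B. B \<subseteq> V \<and> strictly_improving V E X \<theta> (all_to_one B y) \<longrightarrow> B \<subseteq> A'))"
proof -
  interpret graphical_model V E X
    by standard (use graph labels in auto)
  have y: "y v \<in> X v" if "v \<in> V" for v
    using extension(1) that by auto
  have sym_\<theta>: "sym_ivec \<theta>"
    using potentials by (simp add: ivec_space_def sym_ivec_def)
  then have sym: "sym_ivec \<theta>\<psi>"
    by (simp add: sym_ivec_def reparametrized)
  \<comment> \<open>In row \<open>y u\<close> one message cancels the potential and the other leaves
    \<open>- \<theta> (EdgeIx u v (y u) (y v))\<close>, whatever \<open>j\<close> is.\<close>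
  have const: "\<theta>\<psi> (EdgeIx u v (y u) j) = \<theta>\<psi> (EdgeIx u v (y u) (y v))" for u v j
    using sym_ivecD[OF sym_\<theta>, of v u] by (simp add: reparametrized psi_def)
  \<comment> \<open>Strict improvement can be tested with \<open>\<theta>\<psi>\<close>, whose
    constant rows make it equivalent to strict minimality.\<close>
  have improving_iff: "strictly_improving V E X \<theta> (all_to_one B y) \<longleftrightarrow> strict_min \<theta>\<psi> B y"
    if B: "B \<subseteq> V" for B
    using strictly_improving_imp_strict_min[OF y B sym const]
      strict_min_imp_strictly_improving[OF y B sym] strictly_improving_reparam[OF y B]
    by (auto simp: reparametrized)
  have \<mu>0: "\<mu>0 \<in> polytope V"
    using init_min by (simp add: is_arg_min_def)
  have A0: "A0 \<subseteq> V" and fin_A0: "finite A0"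
    using init_set finite_V by (auto simp: integral_nodes_def)
  have \<mu>0_one: "\<mu>0 (NodeIx v (y v)) = 1" if "v \<in> A0" for v
    using proposal that extension(2)[OF that] by (simp add: labeling_of_def)
  \<comment> \<open>\<open>\<mu>0\<close> is optimal for \<open>\<theta>\<psi>\<close> as well, so
    fixing labels cannot lower its energy. The labeling is general because both \<open>y\<close> and
    the output labeling are inserted below.\<close>
  have \<mu>0_fixed: "\<mu>0 (NodeIx v (x v)) = 1"
    if "strict_min \<theta>\<psi> B x" "B \<subseteq> V" "\<And>v. v \<in> B \<Longrightarrow> x v \<in> X v" "v \<in> B" for B x v
  proof -
    have "fix_labels B x \<mu>0 \<in> polytope V"
      using that by (intro fix_labels_in_polytope \<mu>0) auto
    then have "energy E X V \<theta>\<psi> \<mu>0 \<le> energy E X V \<theta>\<psi> (fix_labels B x \<mu>0)"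
      using init_min \<mu>0 by (auto simp: reparametrized energy_reparam is_arg_min_def not_less)
    then show ?thesis
      using strict_min_integral[OF \<mu>0 that(2) subset_refl that(3) sym refl that(1) _ that(4)] by simp
  qed
  \<comment> \<open>Every candidate set lies in the initial set, which is where the invariant
    \<open>prune_state_keeps\<close> starts.\<close>
  have sub_A0: "B \<subseteq> A0" if B: "B \<subseteq> V" and min: "strict_min \<theta>\<psi> B y" for B
  proof
    fix v assume v: "v \<in> B"
    have "\<mu>0 (NodeIx v (y v)) = 1"
      using \<mu>0_fixed[OF min B _ v] y B by auto
    then show "v \<in> A0"
      using node_of_integral[OF \<mu>0 subset_refl, of v "y v"] v B
      by (auto simp: init_set integral_nodes_def)
  qed
  show ?thesis
  proof (intro conjI allI impI)
    show "\<exists>T. \<forall>t A x. prune_state V E X \<theta>\<psi> A0 x0 t A x \<longrightarrow> t \<le> T"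
      using prune_state_bounds[OF _ fin_A0] by (metis add_leD1)
    show "\<exists>A' x'. prune_output V E X \<theta>\<psi> A0 x0 A' x'"
      by (rule prune_output_exists[OF prune_state.start fin_A0]) (use unique in blast)
  next
    fix A x' assume "prune_output V E X \<theta>\<psi> A0 x0 A x'"
    then obtain t x where state: "prune_state V E X \<theta>\<psi> A0 x0 t A x"
      and step: "prune_step V E X \<theta>\<psi> A x A x'"
      by (auto simp: prune_output_def)
    have "A \<subseteq> A0"
      using prune_state_bounds[OF state fin_A0] by simp
    with A0 show A: "A \<subseteq> V" by blast
    have min': "strict_min \<theta>\<psi> A x'"
      by (rule prune_fixpoint_strict_min[OF step A unique[OF state]])
    \<comment> \<open>The labels could have changed during the run, but both are the label on which
      \<open>\<mu>0\<close> concentrates at \<open>v\<close>.\<close>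
    have "x' v = y v" if v: "v \<in> A" for v
    proof -
      have "\<mu>0 (NodeIx v (x' v)) = 1"
        using \<mu>0_fixed[OF min' A _ v] prune_step_shrinks(2)[OF step] by auto
      then show ?thesis
        using node_of_integral[OF \<mu>0 subset_refl _ \<mu>0_one, of v "x' v"] subsetD[OF A v]
          subsetD[OF \<open>A \<subseteq> A0\<close> v] by (simp add: of_bool_def split: if_splits)
    qed
    then have "strict_min \<theta>\<psi> A y"
      using min' strict_min_cong by blast
    then show "strictly_improving V E X \<theta> (all_to_one A y)"
      by (simp add: improving_iff A)
    fix B assume "B \<subseteq> V \<and> strictly_improving V E X \<theta> (all_to_one B y)"
    then have B: "B \<subseteq> V" and min: "strict_min \<theta>\<psi> B y"
      by (auto simp: improving_iff)
    have "y v \<in> X v" "x0 v = y v" if "v \<in> B" for v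
      using that B sub_A0[OF B min] y extension(2) by auto
    then show "B \<subseteq> A"
      using prune_state_keeps[OF state sub_A0[OF B min] A0 sym _ min] by blast
  qed
qed

end
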